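(* Denote by $\mathcal P,\mathcal Q$ the $2n\times2n$ matrices representing the action on $M'$ of $A+B\mathfrak s_1+\sum_{i\ne1}(C_i\mathfrak s_{1i}+D_i\mathfrak s_{1i}^+)$ and $\widetilde u_1t(\epsilon_1)+\widetilde v_1\mathfrak s_1$, respectively. Extend the vectors $\epsilon_i$ and variables $x_i$ to the range $1\le i\le2n$ by $\epsilon_{n+i}=-\epsilon_i$, $x_{n+i}=-x_i$ ($1\le i\le n$), and extend the definitions of $a_{ij}=a(x_i-x_j)$, $b_{ij}=b(x_i-x_j)$, $a_{ij}^+=a(x_i+x_j)$, $u_i=u(x_i)$, $\widetilde u_i=\widetilde u(x_i)$, $\widetilde v_i=\widetilde v(x_i)$ accordingly. Then $$\mathcal P_{ij}=u_jb_{ij}a_{ij}^+\prod_{l=1}^{2n}{}'a_{jl}\quad(i-j\ne0,\pm n),\qquad \mathcal P_{ii}=u_i\prod_{l=1}^{2n}{}'a_{il},$$ $$\mathcal P_{ij}=\tau^{2n-2}\tau_n-\sum_{l\ne j}^{2n}\mathcal P_{il}\quad(i-j=\pm n),$$ $$\mathcal Q_{ij}=\widetilde u_jt(\epsilon_j)\quad(i=j),\qquad \mathcal Q_{ij}=\widetilde v_i\quad(i-j=\pm n),\qquad \mathcal Q_{ij}=0\quad(i-j\ne0,\pm n).$$ Here $\prod'$ indicates that those $l$ are excluded for which either $l-i$ or $l-j$ equals $0,\pm n$ (two values are excluded if $i=j$).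
   Context: $V=\mathbb C^n$ with standard basis $\epsilon_i$ and coordinates $x_i$; $\mathbb C(V)$: meromorphic functions on $V$; $W=\mathfrak S_n\ltimes\{\pm1\}^n$ acts by signed permutations. $\mathfrak s_{ij}$ transposes $x_i,x_j$; $\mathfrak s_i$ changes the sign of $x_i$; $\mathfrak s_{ij}^+=\mathfrak s_{ij}\mathfrak s_i\mathfrak s_j$ ($x_i\mapsto-x_j$, $x_j\mapsto-x_i$). For fixed $c$, $q=e^c$, and $\lambda\in\Lambda=\bigoplus\mathbb Z\epsilon_i$, $t(\lambda)$ acts on functions by $f(x)\mapsto f(x+c\lambda)$; $\mathcal D_q$ is the algebra generated by $\mathbb C(V)$ and $t(\Lambda)$, and $\mathcal D_q*W$ its crossed product with $W$. Parameters $\tau,\tau_0,\tau_0^\vee,\tau_n,\tau_n^\vee$ are nonzero constants, and $$a(z)=\frac{\tau^{-1}-\tau e^z}{1-e^z},\quad b(z)=\frac{\tau-\tau^{-1}}{1-e^z},\quad u(z)=\tau_n^{-1}\frac{(1-\tau_n\tau_n^\vee e^z)(1+\tau_n(\tau_n^\vee)^{-1}e^z)}{1-e^{2z}},$$ $$\widetilde u(z)=\tau_0^{-1}\frac{(1-\tau_0\tau_0^\vee q^{1/2}e^z)(1+\tau_0(\tau_0^\vee)^{-1}q^{1/2}e^z)}{1-qe^{2z}},\quad \widetilde v(z)=\tau_0-\widetilde u(z),\qquad q^{1/2}=e^{c/2}.$$ Write $a_{ij}=a(x_i-x_j)$, $b_{ij}=b(x_i-x_j)$, $a^\pm_{ij}=a(\pm(x_i+x_j))$,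 $b_{ij}^+=b(x_i+x_j)$, $u_i=u(x_i)$, $u_i^-=u(-x_i)$, $\widetilde u_i=\widetilde u(x_i)$, $\widetilde v_i=\widetilde v(x_i)$. Put $$A=u_1\prod_{l\ne1}^na_{1l}a_{1l}^+,\quad C_i=u_ib_{1i}a_{1i}^+\prod_{l\ne1,i}a_{il}a_{il}^+,\quad D_i=u_i^-b_{1i}^+a_{1i}\prod_{l\ne1,i}a_{li}^-a_{li},\quad B=\tau^{2n-2}\tau_n-A-\sum_{i\ne1}(C_i+D_i)$$ (products over $1\le l\le n$). $W'\subset W$ is the stabiliser of $\epsilon_1$ (signed permutations of $x_2,\dots,x_n$), $e'=|W'|^{-1}\sum_{w\in W'}w$, $M=\mathrm{Ind}_{\mathcal D_q}^{\mathcal D_q*W}\mathbb C(V)\cong\mathbb CW\otimes\mathbb C(V)$ (elements $\sum_wwf_w$), $M'=e'M$. Elements of $M'$ are written $\sum_{j=1}^{2n}e'r_jf_j$, $f_j\in\mathbb C(V)$, where $r_i=\mathfrak s_{1i}$, $r_{n+i}=\mathfrak s_{1i}^+$ ($1\le i\le n$), $r_1=\mathrm{id}$, $r_{n+1}=\mathfrak s_1$. An operator $Z\in\mathcal D_q*W$ preserving $M'$ is represented by the matrix $(Z_{kj})$, $Z_{kj}\in\mathcal D_q$, with $Z\sum_je'r_jf_j=\sum_{k,j}e'r_kZ_{kj}f_j$. *)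

theory Defs
  imports "HOL-Analysis.Analysis" "HOL-Library.Function_Algebras"
begin

section \<open>Meromorphic functions on V\<close>

text \<open>Throughout, \<open>V\<close> is \<^typ>\<open>complex ^ 'n\<close>, so that \<open>n\<close> is \<open>CARD('n)\<close>.\<close>

definition holo_on :: "(complex ^ 'n \<Rightarrow> complex) \<Rightarrow> (complex ^ 'n) set \<Rightarrow> bool" where
  "holo_on g U \<longleftrightarrow>
     (\<forall>x\<in>U. \<exists>D. (g has_derivative D) (at x) \<and> (\<forall>k v. D (k *s v) = k * D v))"

definition open_dense :: "'a::topological_space set \<Rightarrow> bool" where
  "open_dense S \<longleftrightarrow> open S \<and> closure S = UNIV"

text \<open>A total function is (a representative of) a meromorphic function if near every point it is
  a quotient of holomorphic functions, the denominator vanishing identically on no nonempty open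
  set. Its values at the zeros of the denominators are irrelevant: representatives that agree on a
  dense open set are identified below.\<close>

definition is_mero :: "(complex ^ 'n \<Rightarrow> complex) \<Rightarrow> bool" where
  "is_mero F \<longleftrightarrow> (\<forall>p. \<exists>U g h. open U \<and> p \<in> U \<and> holo_on g U \<and> holo_on h U \<and>
     (\<forall>T. open T \<and> T \<noteq> {} \<and> T \<subseteq> U \<longrightarrow> (\<exists>x\<in>T. h x \<noteq> 0)) \<and>
     (\<forall>x\<in>U. h x \<noteq> 0 \<longrightarrow> F x = g x / h x))"

definition mero_rel :: "(complex ^ 'n \<Rightarrow> complex) \<Rightarrow> (complex ^ 'n \<Rightarrow> complex) \<Rightarrow> bool" where
  "mero_rel F G \<longleftrightarrow> is_mero F \<and> is_mero G \<and> (\<exists>S. open_dense S \<and> (\<forall>x\<in>S. F x = G x))"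

lemma open_dense_iff: "open_dense S \<longleftrightarrow> open S \<and> (\<forall>T. open T \<and> T \<noteq> {} \<longrightarrow> S \<inter> T \<noteq> {})"
proof -
  have "closure S = UNIV \<longleftrightarrow> (\<forall>T. open T \<and> T \<noteq> {} \<longrightarrow> S \<inter> T \<noteq> {})"
  proof
    assume "closure S = UNIV"
    then show "\<forall>T. open T \<and> T \<noteq> {} \<longrightarrow> S \<inter> T \<noteq> {}"
      by (metis Int_UNIV_right Int_commute open_Int_closure_eq_empty)
  next
    assume *: "\<forall>T. open T \<and> T \<noteq> {} \<longrightarrow> S \<inter> T \<noteq> {}"
    have "- closure S = {}"
      using *[rule_format, of "- closure S"] closure_subset[of S] by (auto simp: open_Compl)
    then show "closure S = UNIV" by auto
  qed
  then show ?thesis by (simp add: open_dense_def)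
qed

lemma open_dense_UNIV [simp]: "open_dense UNIV"
  by (simp add: open_dense_def)

lemma open_dense_Int: "open_dense S \<Longrightarrow> open_dense T \<Longrightarrow> open_dense (S \<inter> T)"
  unfolding open_dense_iff by (metis Int_assoc inf.left_commute open_Int)

lemma open_dense_vimage:
  fixes f :: "'a::topological_space \<Rightarrow> 'b::topological_space"
  assumes S: "open_dense S"
    and f: "continuous_on UNIV f" and g: "continuous_on UNIV g"
    and fg: "\<And>x. f (g x) = x" and gf: "\<And>x. g (f x) = x"
  shows "open_dense (f -` S)"
  unfolding open_dense_iff
proof (intro conjI allI impI)
  show "open (f -` S)"
    using S f by (simp add: open_dense_def open_vimage)
  fix T :: "'a set" assume T: "open T \<and> T \<noteq> {}"
  then have "open (g -` T)" using g by (simp add: open_vimage)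
  moreover have "g -` T \<noteq> {}" using T gf by (metis ex_in_conv vimageI)
  ultimately obtain y where "y \<in> S" "g y \<in> T"
    using S unfolding open_dense_iff by blast
  then have "g y \<in> f -` S \<inter> T" using fg by simp
  then show "f -` S \<inter> T \<noteq> {}" by blast
qed

lemma holo_on_subset: "holo_on g U \<Longrightarrow> T \<subseteq> U \<Longrightarrow> holo_on g T"
  unfolding holo_on_def by blast

lemma holo_on_const: "holo_on (\<lambda>_. k) U"
  unfolding holo_on_def by (auto intro!: exI[of _ "\<lambda>_. 0"])

lemma holo_on_add: "holo_on g U \<Longrightarrow> holo_on h U \<Longrightarrow> holo_on (\<lambda>x. g x + h x) U"
  unfolding holo_on_def
proof (intro ballI)
  fix x assume "\<forall>x\<in>U. \<exists>D. (g has_derivative D) (at x) \<and> (\<forall>k v. D (k *s v) = k * D v)"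
    "\<forall>x\<in>U. \<exists>D. (h has_derivative D) (at x) \<and> (\<forall>k v. D (k *s v) = k * D v)" "x \<in> U"
  then obtain D E where "(g has_derivative D) (at x)" "(h has_derivative E) (at x)"
    "\<forall>k v. D (k *s v) = k * D v" "\<forall>k v. E (k *s v) = k * E v" by blast
  then show "\<exists>D. ((\<lambda>x. g x + h x) has_derivative D) (at x) \<and> (\<forall>k v. D (k *s v) = k * D v)"
    by (intro exI[of _ "\<lambda>v. D v + E v"] conjI has_derivative_add) (auto simp: algebra_simps)
qed

lemma holo_on_mult: "holo_on g U \<Longrightarrow> holo_on h U \<Longrightarrow> holo_on (\<lambda>x. g x * h x) U"
  unfolding holo_on_def
proof (intro ballI)
  fix x assume "\<forall>x\<in>U. \<exists>D. (g has_derivative D) (at x) \<and> (\<forall>k v. D (k *s v) = k * D v)"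
    "\<forall>x\<in>U. \<exists>D. (h has_derivative D) (at x) \<and> (\<forall>k v. D (k *s v) = k * D v)" "x \<in> U"
  then obtain D E where "(g has_derivative D) (at x)" "(h has_derivative E) (at x)"
    "\<forall>k v. D (k *s v) = k * D v" "\<forall>k v. E (k *s v) = k * E v" by blast
  then show "\<exists>D. ((\<lambda>x. g x * h x) has_derivative D) (at x) \<and> (\<forall>k v. D (k *s v) = k * D v)"
    by (intro exI[of _ "\<lambda>v. g x * E v + D v * h x"] conjI has_derivative_mult)
       (auto simp: algebra_simps)
qed

lemma holo_on_exp: "holo_on g U \<Longrightarrow> holo_on (\<lambda>x. exp (g x)) U"
  unfolding holo_on_def
proof (intro ballI)
  fix x assume "\<forall>x\<in>U. \<exists>D. (g has_derivative D) (at x) \<and> (\<forall>k v. D (k *s v) = k * D v)" "x \<in> U"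
  then obtain D where D: "(g has_derivative D) (at x)" "\<forall>k v. D (k *s v) = k * D v" by blast
  have "(exp has_derivative (*) (exp (g x))) (at (g x))"
    using DERIV_exp[of "g x"] by (simp add: has_field_derivative_def)
  from has_derivative_compose[OF D(1) this]
  show "\<exists>D. ((\<lambda>x. exp (g x)) has_derivative D) (at x) \<and> (\<forall>k v. D (k *s v) = k * D v)"
    using D(2) by (intro exI[of _ "\<lambda>v. exp (g x) * D v"]) (auto simp: algebra_simps)
qed

lemma holo_on_nth: "holo_on (\<lambda>x. x $ k) U"
  unfolding holo_on_def
  by (auto intro!: exI[of _ "\<lambda>x. x $ k"] bounded_linear_imp_has_derivative bounded_linear_vec_nth)

lemma holo_on_affine:
  fixes L :: "complex ^ 'n \<Rightarrow> complex ^ 'm"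
  assumes g: "holo_on g U" and L: "bounded_linear L" "\<And>k v. L (k *s v) = k *s L v"
  shows "holo_on (\<lambda>x. g (L x + b)) ((\<lambda>x. L x + b) -` U)"
  unfolding holo_on_def
proof (intro ballI)
  fix x assume "x \<in> (\<lambda>x. L x + b) -` U"
  then obtain D where D: "(g has_derivative D) (at (L x + b))" "\<forall>k v. D (k *s v) = k * D v"
    using g unfolding holo_on_def by auto
  have "((\<lambda>x. L x + b) has_derivative L) (at x)"
    using bounded_linear_imp_has_derivative[OF L(1)] by (auto intro!: derivative_eq_intros)
  from has_derivative_compose[OF this D(1)]
  show "\<exists>D. ((\<lambda>x. g (L x + b)) has_derivative D) (at x) \<and> (\<forall>k v. D (k *s v) = k * D v)"
    using D(2) L(2) by (intro exI[of _ "\<lambda>v. D (L v)"]) auto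
qed

lemma holo_on_continuous: "holo_on g U \<Longrightarrow> continuous_on U g"
  unfolding holo_on_def
  by (meson continuous_at_imp_continuous_on has_derivative_continuous)

lemma is_mero_quotient:
  fixes g h :: "complex ^ 'n \<Rightarrow> complex"
  assumes "holo_on g UNIV" "holo_on h UNIV"
    and "\<And>T. open T \<Longrightarrow> T \<noteq> {} \<Longrightarrow> \<exists>x\<in>T. h x \<noteq> 0"
    and "\<And>x. h x \<noteq> 0 \<Longrightarrow> F x = g x / h x"
  shows "is_mero F"
  unfolding is_mero_def
  by (rule allI, rule exI[of _ UNIV], rule exI[of _ g], rule exI[of _ h]) (use assms in auto)

lemma is_mero_const: "is_mero (\<lambda>_. k)"
  by (rule is_mero_quotient[of "\<lambda>_. k" "\<lambda>_. 1"]) (auto simp: holo_on_const)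

lemma nonvanish_mult:
  fixes h k :: "complex ^ 'n \<Rightarrow> complex"
  assumes h: "continuous_on U h" "\<And>T. open T \<Longrightarrow> T \<noteq> {} \<Longrightarrow> T \<subseteq> U \<Longrightarrow> \<exists>x\<in>T. h x \<noteq> 0"
    and k: "\<And>T. open T \<Longrightarrow> T \<noteq> {} \<Longrightarrow> T \<subseteq> U \<Longrightarrow> \<exists>x\<in>T. k x \<noteq> 0"
    and T: "open T" "T \<noteq> {}" "T \<subseteq> U"
  shows "\<exists>x\<in>T. h x * k x \<noteq> 0"
proof -
  let ?T = "T \<inter> h -` (- {0})"
  have "open ?T"
    using continuous_on_subset[OF h(1) T(3)] T(1)
    by (metis continuous_on_open_vimage open_Compl finite_imp_closed finite.emptyI finite_insert inf_commute)
  moreover have "?T \<noteq> {}" using h(2)[OF T] by blast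
  ultimately obtain x where "x \<in> ?T" "k x \<noteq> 0" using k T(3) by blast
  then show ?thesis by auto
qed

lemma is_mero_common:
  fixes F G :: "complex ^ 'n \<Rightarrow> complex"
  assumes F: "is_mero F" and G: "is_mero G"
  shows "\<exists>U f g h. open U \<and> p \<in> U \<and> holo_on f U \<and> holo_on g U \<and> holo_on h U \<and>
    (\<forall>T. open T \<and> T \<noteq> {} \<and> T \<subseteq> U \<longrightarrow> (\<exists>x\<in>T. h x \<noteq> 0)) \<and>
    (\<forall>x\<in>U. h x \<noteq> 0 \<longrightarrow> F x = f x / h x \<and> G x = g x / h x)"
proof -
  obtain U1 g1 h1 where 1: "open U1" "p \<in> U1" "holo_on g1 U1" "holo_on h1 U1"
    "\<And>T. open T \<Longrightarrow> T \<noteq> {} \<Longrightarrow> T \<subseteq> U1 \<Longrightarrow> \<exists>x\<in>T. h1 x \<noteq> 0"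
    "\<And>x. x \<in> U1 \<Longrightarrow> h1 x \<noteq> 0 \<Longrightarrow> F x = g1 x / h1 x"
    using F unfolding is_mero_def by metis
  obtain U2 g2 h2 where 2: "open U2" "p \<in> U2" "holo_on g2 U2" "holo_on h2 U2"
    "\<And>T. open T \<Longrightarrow> T \<noteq> {} \<Longrightarrow> T \<subseteq> U2 \<Longrightarrow> \<exists>x\<in>T. h2 x \<noteq> 0"
    "\<And>x. x \<in> U2 \<Longrightarrow> h2 x \<noteq> 0 \<Longrightarrow> G x = g2 x / h2 x"
    using G unfolding is_mero_def by metis
  let ?U = "U1 \<inter> U2"
  have h: "holo_on g1 ?U" "holo_on h1 ?U" "holo_on g2 ?U" "holo_on h2 ?U"
    using 1 2 by (auto intro: holo_on_subset)
  have "\<exists>x\<in>T. h1 x * h2 x \<noteq> 0" if T: "open T" "T \<noteq> {}" "T \<subseteq> ?U" for T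
  proof (rule nonvanish_mult[OF holo_on_continuous[OF h(2)] _ _ T])
    show "\<exists>x\<in>S. h1 x \<noteq> 0" if "open S" "S \<noteq> {}" "S \<subseteq> ?U" for S
      by (rule 1(5)) (use that in auto)
    show "\<exists>x\<in>S. h2 x \<noteq> 0" if "open S" "S \<noteq> {}" "S \<subseteq> ?U" for S
      by (rule 2(5)) (use that in auto)
  qed
  moreover have "F x = g1 x * h2 x / (h1 x * h2 x) \<and> G x = g2 x * h1 x / (h1 x * h2 x)"
    if x: "x \<in> ?U" "h1 x * h2 x \<noteq> 0" for x
    using 1(6)[of x] 2(6)[of x] x by simp
  moreover have "open ?U" "p \<in> ?U" using 1(1,2) 2(1,2) by (simp_all add: open_Int)
  ultimately show ?thesis
    using h by (intro exI[of _ ?U]) (rule exI[of _ "\<lambda>x. g1 x * h2 x"], rule exI[of _ "\<lambda>x. g2 x * h1 x"],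
      rule exI[of _ "\<lambda>x. h1 x * h2 x"], simp add: holo_on_mult)
qed

lemma is_mero_add: assumes "is_mero F" "is_mero G" shows "is_mero (\<lambda>x. F x + G x)"
  unfolding is_mero_def
proof
  fix p
  obtain U f g h where *: "open U" "p \<in> U" "holo_on f U" "holo_on g U" "holo_on h U"
    "\<forall>T. open T \<and> T \<noteq> {} \<and> T \<subseteq> U \<longrightarrow> (\<exists>x\<in>T. h x \<noteq> 0)"
    "\<forall>x\<in>U. h x \<noteq> 0 \<longrightarrow> F x = f x / h x \<and> G x = g x / h x"
    using is_mero_common[OF assms, of p] by (elim exE conjE) (rule that)
  show "\<exists>U g h. open U \<and> p \<in> U \<and> holo_on g U \<and> holo_on h U \<and>
     (\<forall>T. open T \<and> T \<noteq> {} \<and> T \<subseteq> U \<longrightarrow> (\<exists>x\<in>T. h x \<noteq> 0)) \<and>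
     (\<forall>x\<in>U. h x \<noteq> 0 \<longrightarrow> F x + G x = g x / h x)"
  proof (rule exI[of _ U], rule exI[of _ "\<lambda>x. f x + g x"], rule exI[of _ "\<lambda>x. h x"], intro conjI allI impI)
    show "holo_on (\<lambda>x. f x + g x) U" "holo_on (\<lambda>x. h x) U"
      using *(3-5) by (simp_all add: holo_on_add holo_on_mult)
    show "\<exists>x\<in>T. h x \<noteq> 0" if "open T \<and> T \<noteq> {} \<and> T \<subseteq> U" for T
      using *(6) that by simp
    show "\<forall>x\<in>U. h x \<noteq> 0 \<longrightarrow> F x + G x = (f x + g x) / (h x)"
      using *(7) by (simp add: add_divide_distrib)
  qed (use *(1,2) in simp_all)
qed

lemma is_mero_mult: assumes "is_mero F" "is_mero G" shows "is_mero (\<lambda>x. F x * G x)"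
  unfolding is_mero_def
proof
  fix p
  obtain U f g h where *: "open U" "p \<in> U" "holo_on f U" "holo_on g U" "holo_on h U"
    "\<forall>T. open T \<and> T \<noteq> {} \<and> T \<subseteq> U \<longrightarrow> (\<exists>x\<in>T. h x \<noteq> 0)"
    "\<forall>x\<in>U. h x \<noteq> 0 \<longrightarrow> F x = f x / h x \<and> G x = g x / h x"
    using is_mero_common[OF assms, of p] by (elim exE conjE) (rule that)
  show "\<exists>U g h. open U \<and> p \<in> U \<and> holo_on g U \<and> holo_on h U \<and>
     (\<forall>T. open T \<and> T \<noteq> {} \<and> T \<subseteq> U \<longrightarrow> (\<exists>x\<in>T. h x \<noteq> 0)) \<and>
     (\<forall>x\<in>U. h x \<noteq> 0 \<longrightarrow> F x * G x = g x / h x)"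
  proof (rule exI[of _ U], rule exI[of _ "\<lambda>x. f x * g x"], rule exI[of _ "\<lambda>x. h x * h x"], intro conjI allI impI)
    show "holo_on (\<lambda>x. f x * g x) U" "holo_on (\<lambda>x. h x * h x) U"
      using *(3-5) by (simp_all add: holo_on_add holo_on_mult)
    show "\<exists>x\<in>T. h x * h x \<noteq> 0" if "open T \<and> T \<noteq> {} \<and> T \<subseteq> U" for T
      using *(6) that by simp
    show "\<forall>x\<in>U. h x * h x \<noteq> 0 \<longrightarrow> F x * G x = (f x * g x) / (h x * h x)"
      using *(7) by (simp add: add_divide_distrib)
  qed (use *(1,2) in simp_all)
qed

lemma is_mero_affine:
  fixes L L' :: "complex ^ 'n \<Rightarrow> complex ^ 'n"
  assumes F: "is_mero F" and L: "bounded_linear L" "\<And>k v. L (k *s v) = k *s L v"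
    and L': "bounded_linear L'" "\<And>x. L (L' x) = x" "\<And>x. L' (L x) = x"
  shows "is_mero (\<lambda>x. F (L x + b))"
  unfolding is_mero_def
proof
  fix p
  let ?T = "\<lambda>x. L x + b" and ?T' = "\<lambda>x. L' (x - b)"
  obtain U g h where *: "open U" "?T p \<in> U" "holo_on g U" "holo_on h U"
    "\<And>T. open T \<Longrightarrow> T \<noteq> {} \<Longrightarrow> T \<subseteq> U \<Longrightarrow> \<exists>x\<in>T. h x \<noteq> 0"
    "\<And>x. x \<in> U \<Longrightarrow> h x \<noteq> 0 \<Longrightarrow> F x = g x / h x"
    using F unfolding is_mero_def by metis
  have c: "continuous_on UNIV ?T" "continuous_on UNIV ?T'"
    using linear_continuous_on[OF L(1)] linear_continuous_on[OF L'(1)]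
    by (auto intro!: continuous_intros intro: continuous_on_compose2)
  have nv: "\<exists>x\<in>T. h (?T x) \<noteq> 0" if T: "open T" "T \<noteq> {}" "T \<subseteq> ?T -` U" for T
  proof -
    have "open (?T' -` T)" using T(1) c(2) by (simp add: open_vimage)
    moreover have "?T' -` T \<noteq> {}"
    proof -
      obtain y where "y \<in> T" using T(2) by blast
      then have "?T y \<in> ?T' -` T" by (simp add: L')
      then show ?thesis by blast
    qed
    moreover have "?T' -` T \<subseteq> U"
    proof
      fix x assume "x \<in> ?T' -` T"
      then have "?T (?T' x) \<in> U" using T(3) by blast
      then show "x \<in> U" by (simp add: L')
    qed
    ultimately obtain x where "?T' x \<in> T" "h x \<noteq> 0" using *(5) by blast
    then show ?thesis by (intro bexI[of _ "?T' x"]) (auto simp: L')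
  qed
  show "\<exists>U g h. open U \<and> p \<in> U \<and> holo_on g U \<and> holo_on h U \<and>
     (\<forall>T. open T \<and> T \<noteq> {} \<and> T \<subseteq> U \<longrightarrow> (\<exists>x\<in>T. h x \<noteq> 0)) \<and>
     (\<forall>x\<in>U. h x \<noteq> 0 \<longrightarrow> F (?T x) = g x / h x)"
  proof (rule exI[of _ "?T -` U"], rule exI[of _ "\<lambda>x. g (?T x)"], rule exI[of _ "\<lambda>x. h (?T x)"], intro conjI allI impI)
    show "holo_on (\<lambda>x. g (?T x)) (?T -` U)" "holo_on (\<lambda>x. h (?T x)) (?T -` U)"
      by (rule holo_on_affine[OF *(3) L] holo_on_affine[OF *(4) L])+
    show "open (?T -` U)" using *(1) c(1) by (rule open_vimage)
    show "p \<in> ?T -` U" using *(2) by simp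
    show "\<exists>x\<in>T. h (?T x) \<noteq> 0" if "open T \<and> T \<noteq> {} \<and> T \<subseteq> ?T -` U" for T
      using that nv by blast
    show "\<forall>x\<in>?T -` U. h (?T x) \<noteq> 0 \<longrightarrow> F (?T x) = g (?T x) / h (?T x)"
      using *(6) by simp
  qed
qed

lemma mero_rel_part_equivp: "part_equivp (mero_rel :: (complex ^ 'n \<Rightarrow> complex) \<Rightarrow> _)"
proof (rule part_equivpI)
  show "\<exists>F. mero_rel F (F :: complex ^ 'n \<Rightarrow> complex)"
    by (rule exI[of _ "\<lambda>_. 0"]) (auto simp: mero_rel_def is_mero_const intro!: exI[of _ UNIV])
  show "symp (mero_rel :: (complex ^ 'n \<Rightarrow> complex) \<Rightarrow> _)"
    unfolding symp_def mero_rel_def by metis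
  show "transp (mero_rel :: (complex ^ 'n \<Rightarrow> complex) \<Rightarrow> _)"
    unfolding transp_def mero_rel_def by (metis IntD1 IntD2 open_dense_Int)
qed

quotient_type (overloaded) 'n mero = "complex ^ 'n::finite \<Rightarrow> complex" / partial: mero_rel
  by (rule mero_rel_part_equivp)

lemma mero_rel_refl: "is_mero F \<Longrightarrow> mero_rel F F"
  unfolding mero_rel_def using open_dense_UNIV by blast

lemma mero_rel_op2:
  assumes "mero_rel F F'" "mero_rel G G'" "is_mero (\<lambda>x. H (F x) (G x))" "is_mero (\<lambda>x. H (F' x) (G' x))"
  shows "mero_rel (\<lambda>x. H (F x) (G x)) (\<lambda>x. H (F' x) (G' x))"
proof -
  obtain S T where "open_dense S" "open_dense T" "\<forall>x\<in>S. F x = F' x" "\<forall>x\<in>T. G x = G' x"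
    using assms unfolding mero_rel_def by metis
  then have "open_dense (S \<inter> T) \<and> (\<forall>x\<in>S \<inter> T. H (F x) (G x) = H (F' x) (G' x))"
    by (auto simp: open_dense_Int)
  then show ?thesis using assms unfolding mero_rel_def by blast
qed

instantiation mero :: (finite) comm_ring_1
begin

lift_definition zero_mero :: "'a mero" is "\<lambda>_. 0"
  by (rule mero_rel_refl[OF is_mero_const])

lift_definition one_mero :: "'a mero" is "\<lambda>_. 1"
  by (rule mero_rel_refl[OF is_mero_const])

lift_definition plus_mero :: "'a mero \<Rightarrow> 'a mero \<Rightarrow> 'a mero" is "\<lambda>F G x. F x + G x"
  by (rule mero_rel_op2; (assumption | rule is_mero_add)?) (auto simp: mero_rel_def)

lift_definition times_mero :: "'a mero \<Rightarrow> 'a mero \<Rightarrow> 'a mero" is "\<lambda>F G x. F x * G x"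
  by (rule mero_rel_op2; (assumption | rule is_mero_mult)?) (auto simp: mero_rel_def)

lift_definition uminus_mero :: "'a mero \<Rightarrow> 'a mero" is "\<lambda>F x. - F x"
proof -
  fix F G :: "complex ^ 'a \<Rightarrow> complex" assume FG: "mero_rel F G"
  have "is_mero (\<lambda>x. - H x)" if "is_mero H" for H :: "complex ^ 'a \<Rightarrow> complex"
    using is_mero_mult[OF is_mero_const[of "-1"] that] by simp
  then show "mero_rel (\<lambda>x. - F x) (\<lambda>x. - G x)"
    using FG by (intro mero_rel_op2[of F G F G "\<lambda>a b. - a"]) (auto simp: mero_rel_def)
qed

definition minus_mero :: "'a mero \<Rightarrow> 'a mero \<Rightarrow> 'a mero" where
  "minus_mero f g = f + - g"

instance
proof
  have *: "mero_rel F G" if "is_mero F" "F = G" for F G :: "complex ^ 'a \<Rightarrow> complex"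
    using mero_rel_refl that by simp
  have m: "is_mero (\<lambda>x. - H x)" if "is_mero H" for H :: "complex ^ 'a \<Rightarrow> complex"
    using is_mero_mult[OF is_mero_const[of "-1"] that] by simp
  note i = is_mero_add is_mero_mult is_mero_const m
  fix a b c :: "'a mero"
  show "a + b + c = a + (b + c)"
    by transfer (rule *, auto simp: mero_rel_def add.assoc intro!: i)
  show "a + b = b + a"
    by transfer (rule *, auto simp: mero_rel_def add.commute intro!: i)
  show "0 + a = a"
    by transfer (rule *, auto simp: mero_rel_def intro!: i)
  show "- a + a = 0"
    by transfer (rule *, auto simp: mero_rel_def intro!: i)
  show "a - b = a + - b"
    by (simp add: minus_mero_def)
  show "a * b * c = a * (b * c)"
    by transfer (rule *, auto simp: mero_rel_def mult.assoc intro!: i)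
  show "a * b = b * a"
    by transfer (rule *, auto simp: mero_rel_def mult.commute intro!: i)
  show "1 * a = a"
    by transfer (rule *, auto simp: mero_rel_def intro!: i)
  show "(a + b) * c = a * c + b * c"
    by transfer (rule *, auto simp: mero_rel_def distrib_right intro!: i)
  show "(0 :: 'a mero) \<noteq> 1"
  proof (transfer, rule notI)
    assume "mero_rel (\<lambda>_ :: complex ^ 'a. 0) (\<lambda>_. 1)"
    then obtain S :: "(complex ^ 'a) set" where "open_dense S" "S = {}"
      unfolding mero_rel_def by auto
    then show False by (simp add: open_dense_def)
  qed
qed

end

text \<open>The meromorphic function given by an explicit formula. The value \<open>0\<close> for a formula
  that is not meromorphic is a dummy; see \<open>is_mero_formulas\<close> below for the
  formulas in use.\<close>

lift_definition mero_of :: "(complex ^ 'n \<Rightarrow> complex) \<Rightarrow> 'n mero" is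
  "\<lambda>F. if is_mero F then F else (\<lambda>_. 0)"
  by (auto intro: mero_rel_refl is_mero_const)

lemma mero_of_eq_iff:
  assumes "is_mero F" "is_mero G"
  shows "mero_of F = mero_of G \<longleftrightarrow> (\<exists>S. open_dense S \<and> (\<forall>x\<in>S. F x = G x))"
  using assms by transfer (auto simp: mero_rel_def)

abbreviation mconst :: "complex \<Rightarrow> 'n::finite mero" where
  "mconst k \<equiv> mero_of (\<lambda>_. k)"


section \<open>The group W\<close>

typedef 'n sperm = "{w :: complex ^ 'n \<Rightarrow> complex ^ 'n.
    \<exists>p s. bij p \<and> (\<forall>k. s k \<in> {1, -1}) \<and> w = (\<lambda>x. \<chi> k. s k * x $ p k)}"
  morphisms act Sperm
  by (rule exI[of _ "\<lambda>x. x"], rule CollectI, rule exI[of _ id], rule exI[of _ "\<lambda>_. 1"])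
     (simp add: fun_eq_iff vec_eq_iff)

setup_lifting type_definition_sperm

instantiation sperm :: (finite) "{monoid_mult, inverse}"
begin

lift_definition one_sperm :: "'a sperm" is "\<lambda>x. x"
  by (rule exI[of _ id], rule exI[of _ "\<lambda>_. 1"]) (simp add: fun_eq_iff vec_eq_iff)

lift_definition times_sperm :: "'a sperm \<Rightarrow> 'a sperm \<Rightarrow> 'a sperm" is "\<lambda>v w. v \<circ> w"
proof clarsimp
  fix p q :: "'a \<Rightarrow> 'a" and s t :: "'a \<Rightarrow> complex"
  assume p: "bij p" and q: "bij q"
    and s: "\<forall>k. s k = 1 \<or> s k = -1" and t: "\<forall>k. t k = 1 \<or> t k = -1"
  have "s k * t (p k) = 1 \<or> s k * t (p k) = -1" for k
    using s[rule_format, of k] t[rule_format, of "p k"] by auto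
  moreover have "bij (q \<circ> p)" using p q by (rule bij_comp)
  moreover have "(\<lambda>x. \<chi> k. s k * x $ p k) \<circ> (\<lambda>x. \<chi> k. t k * x $ q k) =
      (\<lambda>x. \<chi> k. (s k * t (p k)) * x $ (q \<circ> p) k)"
    by (simp add: fun_eq_iff vec_eq_iff mult.assoc)
  ultimately show "\<exists>r. bij r \<and> (\<exists>u. (\<forall>k. u k = 1 \<or> u k = -1) \<and>
      (\<lambda>x. \<chi> k. s k * x $ p k) \<circ> (\<lambda>x. \<chi> k. t k * x $ q k) = (\<lambda>x. \<chi> k. u k * x $ r k))"
    by (intro exI[of _ "q \<circ> p"] exI[of _ "\<lambda>k. s k * t (p k)"] conjI allI)
qed

lift_definition inverse_sperm :: "'a sperm \<Rightarrow> 'a sperm" is "\<lambda>w. inv w"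
proof clarsimp
  fix p :: "'a \<Rightarrow> 'a" and s :: "'a \<Rightarrow> complex"
  assume p: "bij p" and s: "\<forall>k. s k = 1 \<or> s k = -1"
  have ss: "s k * (s k * z) = z" for k z using s[rule_format, of k] by auto
  have pp: "p (inv p k) = k" "inv p (p k) = k" for k
    using p by (simp_all add: bij_is_inj bij_is_surj surj_f_inv_f)
  have "inv (\<lambda>x :: complex ^ 'a. \<chi> k. s k * x $ p k) = (\<lambda>x. \<chi> k. s (inv p k) * x $ inv p k)"
    by (rule inv_equality) (simp_all add: vec_eq_iff ss pp)
  moreover have "bij (inv p)" using p by (rule bij_imp_bij_inv)
  moreover have "\<forall>k. s (inv p k) = 1 \<or> s (inv p k) = -1" using s by simp
  ultimately show "\<exists>r. bij r \<and> (\<exists>u. (\<forall>k. u k = 1 \<or> u k = -1) \<and>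
      inv (\<lambda>x :: complex ^ 'a. \<chi> k. s k * x $ p k) = (\<lambda>x. \<chi> k. u k * x $ r k))"
    by (intro exI[of _ "inv p"] exI[of _ "\<lambda>k. s (inv p k)"] conjI)
qed

definition divide_sperm :: "'a sperm \<Rightarrow> 'a sperm \<Rightarrow> 'a sperm" where
  "divide_sperm v w = v * inverse w"

instance
  by standard (transfer; simp add: fun_eq_iff)+

end

lemma act_one [simp]: "act 1 x = x"
  by transfer simp

lemma act_mult [simp]: "act (v * w) x = act v (act w x)"
  by transfer simp

lemma act_linear: "linear (act w)"
  by transfer (auto intro!: linearI simp: vec_eq_iff algebra_simps)

lemma act_bounded_linear: "bounded_linear (act w)"
  using act_linear linear_conv_bounded_linear by blast

lemma act_scale: "act w (k *s v) = k *s act w v"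
  by transfer (auto simp: vec_eq_iff algebra_simps)

lemma act_bij: "bij (act w)"
proof (transfer, clarsimp)
  fix p :: "'a \<Rightarrow> 'a" and s :: "'a \<Rightarrow> complex"
  assume p: "bij p" and s: "\<forall>k. s k = 1 \<or> s k = -1"
  have ss: "s k * (s k * z) = z" for k z using s[rule_format, of k] by auto
  have pp: "p (inv p k) = k" "inv p (p k) = k" for k
    using p by (simp_all add: bij_is_inj bij_is_surj surj_f_inv_f)
  show "bij (\<lambda>x :: complex ^ 'a. \<chi> k. s k * x $ p k)"
    by (rule o_bij[of "\<lambda>x. \<chi> k. s (inv p k) * x $ inv p k"])
       (simp_all add: fun_eq_iff vec_eq_iff ss pp)
qed

lemma act_inverse: "act (inverse w) = inv (act w)"
  by transfer simp

lemma act_inverse_left [simp]: "act (inverse w) (act w x) = x"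
  by (simp add: act_inverse act_bij bij_is_inj)

lemma act_inverse_right [simp]: "act w (act (inverse w) x) = x"
  by (simp add: act_inverse act_bij bij_is_surj surj_f_inv_f)

lemma sperm_eqI: "(\<And>x. act v x = act w x) \<Longrightarrow> v = w"
  by (simp add: act_inject[symmetric] fun_eq_iff)

lemma sperm_inverse_left [simp]: "inverse w * w = (1 :: 'n::finite sperm)"
  by (rule sperm_eqI) simp

lemma sperm_inverse_right [simp]: "w * inverse w = (1 :: 'n::finite sperm)"
  by (rule sperm_eqI) simp

lemma sperm_inverse_mult: "inverse (v * w) = inverse w * inverse (v :: 'n::finite sperm)"
proof (rule sperm_eqI)
  fix x
  have "act (v * w) = act v \<circ> act w" by (simp add: fun_eq_iff)
  then show "act (inverse (v * w)) x = act (inverse w * inverse v) x"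
    by (simp add: act_inverse o_inv_distrib act_bij)
qed

lemma sperm_inverse_inverse [simp]: "inverse (inverse w) = (w :: 'n::finite sperm)"
  by (rule sperm_eqI) (simp add: act_inverse inv_inv_eq act_bij)

instance sperm :: (finite) finite
proof
  let ?f = "\<lambda>(p :: 'a \<Rightarrow> 'a, b :: 'a \<Rightarrow> bool). \<lambda>x :: complex ^ 'a. \<chi> k. (if b k then 1 else -1) * x $ p k"
  have "range act \<subseteq> range ?f"
  proof clarify
    fix w :: "'a sperm"
    obtain p s where w: "\<forall>k. s k \<in> {1, -1}" "act w = (\<lambda>x. \<chi> k. s k * x $ p k)"
      using act[of w] by blast
    have "act w x = ?f (p, \<lambda>k. s k = 1) x" for x
      unfolding w(2) using w(1) by (auto simp: vec_eq_iff)
    then have "act w = ?f (p, \<lambda>k. s k = 1)" by (rule ext)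
    then show "act w \<in> range ?f" by (rule range_eqI)
  qed
  then have "finite (range (act :: 'a sperm \<Rightarrow> _))"
    by (rule finite_subset) simp
  then show "finite (UNIV :: 'a sperm set)"
    by (rule finite_imageD) (auto intro: injI simp: act_inject)
qed

lift_definition swap :: "'n::finite \<Rightarrow> 'n \<Rightarrow> 'n sperm" is
  "\<lambda>p q x. \<chi> k. x $ (if k = p then q else if k = q then p else k)"
proof -
  fix p q :: 'n
  let ?t = "\<lambda>k. if k = p then q else if k = q then p else k"
  have "bij ?t"
    by (rule o_bij[of ?t]) (auto simp: fun_eq_iff)
  then show "\<exists>r s. bij r \<and> (\<forall>k. s k \<in> {1, -1}) \<and>
      (\<lambda>x :: complex ^ 'n. \<chi> k. x $ ?t k) = (\<lambda>x. \<chi> k. s k * x $ r k)"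
    by (intro exI[of _ ?t] exI[of _ "\<lambda>_. 1"]) simp
qed

lift_definition flip :: "'n::finite \<Rightarrow> 'n sperm" is
  "\<lambda>p x. \<chi> k. if k = p then - x $ k else x $ k"
proof -
  fix p :: 'n
  show "\<exists>r s. bij r \<and> (\<forall>k. s k \<in> {1, -1}) \<and>
      (\<lambda>x :: complex ^ 'n. \<chi> k. if k = p then - x $ k else x $ k) = (\<lambda>x. \<chi> k. s k * x $ r k)"
    by (rule exI[of _ id], rule exI[of _ "\<lambda>k. if k = p then -1 else 1"])
       (simp add: vec_eq_iff fun_eq_iff)
qed

lemma is_mero_act: "is_mero F \<Longrightarrow> is_mero (\<lambda>x. F (act w x))"
  using is_mero_affine[OF _ act_bounded_linear[of w] act_scale act_bounded_linear[of "inverse w"], of F 0]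
  by simp

lemma is_mero_translate: "is_mero F \<Longrightarrow> is_mero (\<lambda>x. F (x + v))"
  using is_mero_affine[OF _ bounded_linear_ident _ bounded_linear_ident, of F v] by simp

text \<open>\<open>(wf)(x) = f(w\<^sup>-\<^sup>1x)\<close>\<close>

lift_definition wact :: "'n::finite sperm \<Rightarrow> 'n mero \<Rightarrow> 'n mero" is
  "\<lambda>w F x. F (act (inverse w) x)"
proof -
  fix w :: "'n sperm" and F G :: "complex ^ 'n \<Rightarrow> complex" assume FG: "mero_rel F G"
  obtain S where S: "open_dense S" "\<forall>x\<in>S. F x = G x" using FG unfolding mero_rel_def by blast
  have "open_dense (act (inverse w) -` S)"
    by (rule open_dense_vimage[OF S(1), where g = "act w"])
       (auto intro: linear_continuous_on act_bounded_linear)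
  then show "mero_rel (\<lambda>x. F (act (inverse w) x)) (\<lambda>x. G (act (inverse w) x))"
    using FG S is_mero_act unfolding mero_rel_def by blast
qed


section \<open>The algebras \<open>D\<^sub>q\<close> and \<open>D\<^sub>q * W\<close>\<close>

lift_definition shift :: "complex \<Rightarrow> complex ^ 'n \<Rightarrow> 'n mero \<Rightarrow> 'n mero" is
  "\<lambda>c v F x. F (x + c *s v)"
proof -
  fix c and v :: "complex ^ 'n" and F G :: "complex ^ 'n \<Rightarrow> complex" assume FG: "mero_rel F G"
  obtain S where S: "open_dense S" "\<forall>x\<in>S. F x = G x" using FG unfolding mero_rel_def by blast
  have "open_dense ((\<lambda>x. x + c *s v) -` S)"
    by (rule open_dense_vimage[OF S(1), where g = "\<lambda>x. x - c *s v"]) (auto intro!: continuous_intros)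
  then show "mero_rel (\<lambda>x. F (x + c *s v)) (\<lambda>x. G (x + c *s v))"
    using FG S is_mero_translate unfolding mero_rel_def by blast
qed

definition lattice :: "(complex ^ 'n) set" where
  "lattice = {v. \<forall>k. v $ k \<in> \<int>}"

type_synonym 'n oper = "'n mero \<Rightarrow> 'n mero"

definition mul :: "'n mero \<Rightarrow> 'n::finite oper" where
  "mul f = (\<lambda>g. f * g)"

text \<open>\<open>D\<^sub>q\<close> as an algebra of operators on \<open>\<complex>(V)\<close>, with composition as product and pointwise sum
  (scalars are multiplications by constants).\<close>

inductive_set Dq :: "complex \<Rightarrow> ('n::finite oper) set" for c where
  mul: "mul f \<in> Dq c"
| shift: "v \<in> lattice \<Longrightarrow> shift c v \<in> Dq c"
| add: "d \<in> Dq c \<Longrightarrow> d' \<in> Dq c \<Longrightarrow> d + d' \<in> Dq c"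
| comp: "d \<in> Dq c \<Longrightarrow> d' \<in> Dq c \<Longrightarrow> d \<circ> d' \<in> Dq c"

text \<open>The action of \<open>W\<close> on \<open>D\<^sub>q\<close> by automorphisms.\<close>

definition conj_op :: "'n::finite sperm \<Rightarrow> 'n oper \<Rightarrow> 'n oper" where
  "conj_op w d = wact w \<circ> d \<circ> wact (inverse w)"

text \<open>An element \<open>\<Sum>\<^sub>w d\<^sub>w w\<close> of the crossed product is encoded by its coefficients \<open>w \<mapsto> d\<^sub>w\<close>; addition is
  that of functions, and \<open>(d w)(d' w') = (d \<cdot> w(d')) ww'\<close>.\<close>

type_synonym 'n cross = "'n sperm \<Rightarrow> 'n oper"

definition DqW :: "complex \<Rightarrow> ('n::finite cross) set" where
  "DqW c = {Z. \<forall>w. Z w \<in> Dq c}"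

definition term_of :: "'n::finite oper \<Rightarrow> 'n sperm \<Rightarrow> 'n cross"  (infix "\<cdot>" 75) where
  "d \<cdot> w = (\<lambda>v. if v = w then d else 0)"

definition cross_mult :: "'n::finite cross \<Rightarrow> 'n cross \<Rightarrow> 'n cross" where
  "cross_mult Y Z = (\<lambda>v. \<Sum>w\<in>UNIV. Y w \<circ> conj_op w (Z (inverse w * v)))"


section \<open>The modules M and M'\<close>

text \<open>An element \<open>\<Sum>\<^sub>w w f\<^sub>w\<close> of \<open>M\<close> is encoded by \<open>w \<mapsto> f\<^sub>w\<close>. Since \<open>d w w' f = w w' ((w w')\<^sup>-\<^sup>1(d)) f\<close> in the
  induced module, the coefficient of \<open>Z m\<close> at \<open>v\<close> collects the terms with \<open>w w' = v\<close>.\<close>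

type_synonym 'n indmod = "'n sperm \<Rightarrow> 'n mero"

definition cross_act :: "'n::finite cross \<Rightarrow> 'n indmod \<Rightarrow> 'n indmod" where
  "cross_act Z m = (\<lambda>v. \<Sum>w\<in>UNIV. conj_op (inverse v) (Z w) (m (inverse w * v)))"

lemma sum_fun_apply: "(\<Sum>i\<in>A. F i) x = (\<Sum>i\<in>A. F i x :: 'b::comm_monoid_add)"
  by (induction A rule: infinite_finite_induct) auto

lemma wact_add: "wact w (f + g) = wact w f + wact w g"
  by transfer (auto simp: mero_rel_def intro!: exI[of _ UNIV] is_mero_add is_mero_act)

lemma wact_zero [simp]: "wact w 0 = 0"
  by transfer (auto simp: mero_rel_def intro!: exI[of _ UNIV] is_mero_const)

lemma wact_one [simp]: "wact 1 f = f"
proof -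
  have "inverse (1 :: 'a sperm) = 1" by (metis mult_1_right sperm_inverse_left)
  then show ?thesis by transfer (auto simp: mero_rel_def)
qed

lemma wact_mult: "wact (v * w) f = wact v (wact w f)"
  by transfer (auto simp: mero_rel_def sperm_inverse_mult intro!: exI[of _ UNIV] is_mero_act)

lemma wact_sum: "wact w (\<Sum>i\<in>A. f i) = (\<Sum>i\<in>A. wact w (f i))"
  by (induction A rule: infinite_finite_induct) (auto simp: wact_add)

lemma shift_add: "shift c v (f + g) = shift c v f + shift c v g"
  by transfer (auto simp: mero_rel_def intro!: exI[of _ UNIV] is_mero_add is_mero_translate)

lemma Dq_add: "d \<in> Dq c \<Longrightarrow> d (f + g) = d f + d g"
  by (induction d arbitrary: f g rule: Dq.induct) (auto simp: mul_def shift_add algebra_simps)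

lemma Dq_zero: "d \<in> Dq c \<Longrightarrow> d 0 = 0"
  using Dq_add[of d c 0 0] by simp

lemma Dq_sum: "d \<in> Dq c \<Longrightarrow> d (\<Sum>i\<in>A. f i) = (\<Sum>i\<in>A. d (f i))"
  by (induction A rule: infinite_finite_induct) (auto simp: Dq_add Dq_zero)

text \<open>The encoding of \<open>M\<close> is a module over the crossed product.\<close>

lemma cross_act_mult:
  fixes Y Z :: "'n::finite cross"
  assumes Y: "Y \<in> DqW c"
  shows "cross_act (cross_mult Y Z) m = cross_act Y (cross_act Z m)"
proof
  fix v
  have Yw: "Y w \<in> Dq c" for w using Y by (simp add: DqW_def)
  have inv_inv: "inverse (inverse v) = v" for v :: "'n sperm" by simp
  have "cross_act (cross_mult Y Z) m v =
      (\<Sum>t\<in>UNIV. \<Sum>w\<in>UNIV. wact (inverse v) (Y w (wact w (Z (inverse w * t)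
         (wact (inverse w) (wact v (m (inverse t * v))))))))"
    by (simp add: cross_act_def cross_mult_def conj_op_def sum_fun_apply wact_sum)
  also have "\<dots> = (\<Sum>w\<in>UNIV. \<Sum>t\<in>UNIV. wact (inverse v) (Y w (wact w (Z (inverse w * t)
         (wact (inverse w) (wact v (m (inverse t * v))))))))"
    by (rule sum.swap)
  also have "\<dots> = (\<Sum>w\<in>UNIV. \<Sum>t\<in>UNIV. wact (inverse v) (Y w (wact w (Z t
         (wact (inverse w) (wact v (m (inverse t * (inverse w * v)))))))))"
  proof (rule sum.cong[OF refl])
    fix w :: "'n sperm"
    have bij: "bij_betw (\<lambda>t. w * t) UNIV UNIV"
      by (rule bij_betw_byWitness[of _ "\<lambda>t. inverse w * t"]) (simp_all add: mult.assoc[symmetric])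
    show "(\<Sum>t\<in>UNIV. wact (inverse v) (Y w (wact w (Z (inverse w * t)
         (wact (inverse w) (wact v (m (inverse t * v)))))))) =
       (\<Sum>t\<in>UNIV. wact (inverse v) (Y w (wact w (Z t
         (wact (inverse w) (wact v (m (inverse t * (inverse w * v)))))))))"
      by (subst sum.reindex_bij_betw[OF bij, symmetric])
         (simp add: mult.assoc[symmetric] sperm_inverse_mult)
  qed
  also have "\<dots> = cross_act Y (cross_act Z m) v"
    by (simp add: cross_act_def conj_op_def wact_sum Dq_sum[OF Yw] sperm_inverse_mult
        wact_mult[symmetric] mult.assoc[symmetric])
  finally show "cross_act (cross_mult Y Z) m v = cross_act Y (cross_act Z m) v" .
qed

definition elt :: "'n::finite sperm \<Rightarrow> 'n mero \<Rightarrow> 'n indmod" where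
  "elt w f = (\<lambda>v. if v = w then f else 0)"

text \<open>In the remaining definitions \<open>idx\<close> enumerates the coordinates of \<open>V\<close>: it is meant to be a
  bijection from \<open>{1..n}\<close> onto \<^typ>\<open>'n\<close>.\<close>

definition stab1 :: "(nat \<Rightarrow> 'n::finite) \<Rightarrow> 'n sperm set" where
  "stab1 idx = {w. act w (axis (idx 1) 1) = axis (idx 1) 1}"

definition e' :: "(nat \<Rightarrow> 'n::finite) \<Rightarrow> 'n cross" where
  "e' idx = (\<Sum>w\<in>stab1 idx. mul (mconst (1 / of_nat (card (stab1 idx)))) \<cdot> w)"

definition M' :: "(nat \<Rightarrow> 'n::finite) \<Rightarrow> 'n indmod set" where
  "M' idx = range (cross_act (e' idx))"

definition s_ij :: "(nat \<Rightarrow> 'n::finite) \<Rightarrow> nat \<Rightarrow> nat \<Rightarrow> 'n sperm" where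
  "s_ij idx i j = swap (idx i) (idx j)"

definition s_i :: "(nat \<Rightarrow> 'n::finite) \<Rightarrow> nat \<Rightarrow> 'n sperm" where
  "s_i idx i = flip (idx i)"

definition sp_ij :: "(nat \<Rightarrow> 'n::finite) \<Rightarrow> nat \<Rightarrow> nat \<Rightarrow> 'n sperm" where
  "sp_ij idx i j = s_ij idx i j * s_i idx i * s_i idx j"

definition rep :: "(nat \<Rightarrow> 'n::finite) \<Rightarrow> nat \<Rightarrow> 'n sperm" where
  "rep idx j = (if j = 1 then 1
     else if j \<le> CARD('n) then s_ij idx 1 j
     else if j = CARD('n) + 1 then s_i idx 1
     else sp_ij idx 1 (j - CARD('n)))"

text \<open>The element \<open>e' r\<^sub>j f\<close> of \<open>M'\<close>.\<close>

definition er :: "(nat \<Rightarrow> 'n::finite) \<Rightarrow> nat \<Rightarrow> 'n mero \<Rightarrow> 'n indmod" where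
  "er idx j f = cross_act (e' idx) (elt (rep idx j) f)"

definition represents ::
    "complex \<Rightarrow> (nat \<Rightarrow> 'n::finite) \<Rightarrow> 'n cross \<Rightarrow> (nat \<Rightarrow> nat \<Rightarrow> 'n oper) \<Rightarrow> bool" where
  "represents c idx Z P \<longleftrightarrow>
     Z \<in> DqW c \<and> cross_act Z ` M' idx \<subseteq> M' idx \<and>
     (\<forall>k\<in>{1..2 * CARD('n)}. \<forall>j\<in>{1..2 * CARD('n)}. P k j \<in> Dq c) \<and>
     (\<forall>f :: nat \<Rightarrow> 'n mero.
        cross_act Z (\<Sum>j=1..2 * CARD('n). er idx j (f j)) =
        (\<Sum>k=1..2 * CARD('n). \<Sum>j=1..2 * CARD('n). er idx k (P k j (f j))))"


section \<open>Coefficients\<close>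

text \<open>The dual parameters \<open>\<tau>\<^sub>0\<^sup>\<or>\<close>, \<open>\<tau>\<^sub>n\<^sup>\<or>\<close> are written \<open>\<tau>0'\<close>, \<open>\<tau>n'\<close>.\<close>

definition a_fun :: "complex \<Rightarrow> complex \<Rightarrow> complex" where
  "a_fun \<tau> z = (inverse \<tau> - \<tau> * exp z) / (1 - exp z)"

definition b_fun :: "complex \<Rightarrow> complex \<Rightarrow> complex" where
  "b_fun \<tau> z = (\<tau> - inverse \<tau>) / (1 - exp z)"

definition u_fun :: "complex \<Rightarrow> complex \<Rightarrow> complex \<Rightarrow> complex" where
  "u_fun \<tau>n \<tau>n' z = inverse \<tau>n * ((1 - \<tau>n * \<tau>n' * exp z) * (1 + \<tau>n * inverse \<tau>n' * exp z) / (1 - exp (2 * z)))"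

definition ut_fun :: "complex \<Rightarrow> complex \<Rightarrow> complex \<Rightarrow> complex \<Rightarrow> complex" where
  "ut_fun c \<tau>0 \<tau>0' z = inverse \<tau>0 *
     ((1 - \<tau>0 * \<tau>0' * exp (c / 2) * exp z) * (1 + \<tau>0 * inverse \<tau>0' * exp (c / 2) * exp z)
      / (1 - exp c * exp (2 * z)))"

definition vt_fun :: "complex \<Rightarrow> complex \<Rightarrow> complex \<Rightarrow> complex \<Rightarrow> complex" where
  "vt_fun c \<tau>0 \<tau>0' z = \<tau>0 - ut_fun c \<tau>0 \<tau>0' z"

text \<open>Coordinates and vectors for the extended range \<open>1 \<le> i \<le> 2n\<close>.\<close>

definition xc :: "(nat \<Rightarrow> 'n::finite) \<Rightarrow> nat \<Rightarrow> complex ^ 'n \<Rightarrow> complex" where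
  "xc idx i x = (if i \<le> CARD('n) then x $ idx i else - x $ idx (i - CARD('n)))"

definition eps :: "(nat \<Rightarrow> 'n::finite) \<Rightarrow> nat \<Rightarrow> complex ^ 'n" where
  "eps idx i = (if i \<le> CARD('n) then axis (idx i) 1 else - axis (idx (i - CARD('n))) 1)"

lemma holo_on_xc:
  fixes idx :: "nat \<Rightarrow> 'n::finite"
  shows "holo_on (xc idx i) U"
proof -
  have "holo_on (\<lambda>x :: complex ^ 'n. - x $ k) U" for k
    using holo_on_mult[OF holo_on_const[of "-1"] holo_on_nth[of k]] by simp
  then show ?thesis
    by (cases "i \<le> CARD('n)") (simp_all add: xc_def[abs_def] holo_on_nth)
qed

lemma one_minus_exp_nonzero:
  fixes l :: "complex ^ 'n \<Rightarrow> complex"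
  assumes l: "\<And>x t. l (x + t *s v) = l x + t"
    and T: "open T" "T \<noteq> {}"
  shows "\<exists>x\<in>T. 1 - k * exp (l x) \<noteq> 0"
proof (rule ccontr)
  assume "\<not> ?thesis"
  then have *: "k * exp (l x) = 1" if "x \<in> T" for x using that by force
  obtain x where x: "x \<in> T" using T(2) by blast
  let ?g = "\<lambda>t::real. x + complex_of_real t *s v"
  have "continuous_on UNIV ?g"
    by (auto simp: vector_scalar_mult_def intro!: continuous_intros)
  then have "open (?g -` T)" using T(1) by (simp add: open_vimage)
  moreover have "0 \<in> ?g -` T" using x by simp
  ultimately obtain d where "d > 0" and d: "ball 0 d \<subseteq> ?g -` T"
    using open_contains_ball by blast
  then have "d / 2 \<in> ball 0 d" by simp
  with d have "?g (d / 2) \<in> T" by blast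
  from *[OF this] *[OF x] have "exp (complex_of_real (d / 2)) = 1"
    by (simp add: l exp_add mult.assoc[symmetric])
  then have "exp (d / 2) = 1" by (metis exp_of_real of_real_eq_1_iff)
  then show False using \<open>d > 0\<close> by simp
qed

lemma is_mero_exp_quotient:
  assumes "holo_on g UNIV" "holo_on l UNIV" "\<And>x t. l (x + t *s v) = l x + t"
  shows "is_mero (\<lambda>x. g x / (1 - k * exp (l x)))"
proof (rule is_mero_quotient[OF assms(1), of "\<lambda>x. 1 + (- k) * exp (l x)"])
  show "holo_on (\<lambda>x. 1 + (- k) * exp (l x)) UNIV"
    by (intro holo_on_add holo_on_mult holo_on_const holo_on_exp assms)
  show "\<exists>x\<in>T. 1 + - k * exp (l x) \<noteq> 0" if "open T" "T \<noteq> {}" for T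
    using one_minus_exp_nonzero[OF assms(3) that, of k] by simp
qed simp

lemma is_mero_formulas:
  assumes l: "holo_on l UNIV" "\<And>x t. l (x + t *s v) = l x + t"
  shows is_mero_a: "is_mero (\<lambda>x. a_fun \<tau> (l x))"
    and is_mero_b: "is_mero (\<lambda>x. b_fun \<tau> (l x))"
    and is_mero_u: "is_mero (\<lambda>x. u_fun \<tau>n \<tau>n' (l x))"
    and is_mero_ut: "is_mero (\<lambda>x. ut_fun c \<tau>0 \<tau>0' (l x))"
    and is_mero_vt: "is_mero (\<lambda>x. vt_fun c \<tau>0 \<tau>0' (l x))"
proof -
  note h = holo_on_add holo_on_mult holo_on_const holo_on_exp
  have e: "holo_on (\<lambda>x. k + k' * exp (l x)) UNIV" for k k'
    by (intro h l)
  have l2: "holo_on (\<lambda>x. 2 * l x) UNIV"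
    by (intro h l)
  have l2': "2 * l (x + t *s ((1 / 2) *s v)) = 2 * l x + t" for x t
    using l(2)[of x "t / 2"] by (simp add: vector_smult_assoc)
  show "is_mero (\<lambda>x. a_fun \<tau> (l x))"
    using is_mero_exp_quotient[OF e[of "inverse \<tau>" "- \<tau>"] l, of 1] by (simp add: a_fun_def)
  show "is_mero (\<lambda>x. b_fun \<tau> (l x))"
    using is_mero_exp_quotient[OF holo_on_const l, of "\<tau> - inverse \<tau>" 1] by (simp add: b_fun_def)
  show "is_mero (\<lambda>x. u_fun \<tau>n \<tau>n' (l x))"
    using is_mero_mult[OF is_mero_const is_mero_exp_quotient[OF holo_on_mult[OF
        e[of 1 "- (\<tau>n * \<tau>n')"] e[of 1 "\<tau>n * inverse \<tau>n'"]] l2 l2', of 1], of "inverse \<tau>n"]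
    by (simp add: u_fun_def)
  show ut: "is_mero (\<lambda>x. ut_fun c \<tau>0 \<tau>0' (l x))"
    using is_mero_mult[OF is_mero_const is_mero_exp_quotient[OF holo_on_mult[OF
        e[of 1 "- (\<tau>0 * \<tau>0' * exp (c / 2))"] e[of 1 "\<tau>0 * inverse \<tau>0' * exp (c / 2)"]] l2 l2', of "exp c"],
        of "inverse \<tau>0"]
    by (simp add: ut_fun_def)
  show "is_mero (\<lambda>x. vt_fun c \<tau>0 \<tau>0' (l x))"
    using is_mero_add[OF is_mero_const is_mero_mult[OF is_mero_const ut], of "\<tau>0" "-1"]
    by (simp add: vt_fun_def)
qed

text \<open>Coordinates \<open>x\<^sub>i\<close>, \<open>x\<^sub>j\<close> with \<open>i - j \<noteq> 0, \<plusminus>n\<close> are linearly independent, so that the lemmas above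
  apply to all the arguments \<open>\<plusminus>x\<^sub>i \<plusminus> x\<^sub>j\<close> and \<open>\<plusminus>x\<^sub>i\<close> in use.\<close>

lemma xc_eps:
  fixes idx :: "nat \<Rightarrow> 'n::finite"
  assumes idx: "bij_betw idx {1..CARD('n)} UNIV"
    and ij: "i \<in> {1..2 * CARD('n)}" "j \<in> {1..2 * CARD('n)}"
  shows "xc idx i (x + t *s eps idx i) = xc idx i x + t"
    and "int i - int j \<notin> {0, int CARD('n), - int CARD('n)} \<Longrightarrow>
      xc idx j (x + t *s eps idx i) = xc idx j x"
proof -
  have inj: "idx k = idx l \<longleftrightarrow> k = l" if "k \<in> {1..CARD('n)}" "l \<in> {1..CARD('n)}" for k l
    using that idx unfolding bij_betw_def inj_on_def by blast
  show "xc idx i (x + t *s eps idx i) = xc idx i x + t"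
    using ij by (simp add: xc_def eps_def)
  show "xc idx j (x + t *s eps idx i) = xc idx j x"
    if "int i - int j \<notin> {0, int CARD('n), - int CARD('n)}"
  proof -
    define i' where "i' = (if i \<le> CARD('n) then i else i - CARD('n))"
    define j' where "j' = (if j \<le> CARD('n) then j else j - CARD('n))"
    have "i' \<in> {1..CARD('n)}" "j' \<in> {1..CARD('n)}"
      using ij by (auto simp: i'_def j'_def)
    moreover have "i' \<noteq> j'"
      using ij that by (cases "i \<le> CARD('n)"; cases "j \<le> CARD('n)") (simp_all add: i'_def j'_def)
    ultimately have "idx i' \<noteq> idx j'" using inj by blast
    then have "axis (idx i') (1 :: complex) $ idx j' = 0" by (simp add: axis_def)
    moreover have "eps idx i = axis (idx i') 1 \<or> eps idx i = - axis (idx i') 1"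
      by (simp add: eps_def i'_def)
    ultimately have "eps idx i $ idx j' = 0" by auto
    then show ?thesis
      by (cases "j \<le> CARD('n)") (simp_all add: xc_def j'_def)
  qed
qed

context
  fixes idx :: "nat \<Rightarrow> 'n::finite"
begin

definition a_ij :: "complex \<Rightarrow> nat \<Rightarrow> nat \<Rightarrow> 'n mero" where
  "a_ij \<tau> i j = mero_of (\<lambda>x. a_fun \<tau> (xc idx i x - xc idx j x))"

definition ap_ij :: "complex \<Rightarrow> nat \<Rightarrow> nat \<Rightarrow> 'n mero" where
  "ap_ij \<tau> i j = mero_of (\<lambda>x. a_fun \<tau> (xc idx i x + xc idx j x))"

definition am_ij :: "complex \<Rightarrow> nat \<Rightarrow> nat \<Rightarrow> 'n mero" where
  "am_ij \<tau> i j = mero_of (\<lambda>x. a_fun \<tau> (- (xc idx i x + xc idx j x)))"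

definition b_ij :: "complex \<Rightarrow> nat \<Rightarrow> nat \<Rightarrow> 'n mero" where
  "b_ij \<tau> i j = mero_of (\<lambda>x. b_fun \<tau> (xc idx i x - xc idx j x))"

definition bp_ij :: "complex \<Rightarrow> nat \<Rightarrow> nat \<Rightarrow> 'n mero" where
  "bp_ij \<tau> i j = mero_of (\<lambda>x. b_fun \<tau> (xc idx i x + xc idx j x))"

definition u_i :: "complex \<Rightarrow> complex \<Rightarrow> nat \<Rightarrow> 'n mero" where
  "u_i \<tau>n \<tau>n' i = mero_of (\<lambda>x. u_fun \<tau>n \<tau>n' (xc idx i x))"

definition um_i :: "complex \<Rightarrow> complex \<Rightarrow> nat \<Rightarrow> 'n mero" where
  "um_i \<tau>n \<tau>n' i = mero_of (\<lambda>x. u_fun \<tau>n \<tau>n' (- xc idx i x))"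

definition ut_i :: "complex \<Rightarrow> complex \<Rightarrow> complex \<Rightarrow> nat \<Rightarrow> 'n mero" where
  "ut_i c \<tau>0 \<tau>0' i = mero_of (\<lambda>x. ut_fun c \<tau>0 \<tau>0' (xc idx i x))"

definition vt_i :: "complex \<Rightarrow> complex \<Rightarrow> complex \<Rightarrow> nat \<Rightarrow> 'n mero" where
  "vt_i c \<tau>0 \<tau>0' i = mero_of (\<lambda>x. vt_fun c \<tau>0 \<tau>0' (xc idx i x))"

definition cA :: "complex \<Rightarrow> complex \<Rightarrow> complex \<Rightarrow> 'n mero" where
  "cA \<tau> \<tau>n \<tau>n' = u_i \<tau>n \<tau>n' 1 * (\<Prod>l\<in>{1..CARD('n)} - {1}. a_ij \<tau> 1 l * ap_ij \<tau> 1 l)"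

definition cC :: "complex \<Rightarrow> complex \<Rightarrow> complex \<Rightarrow> nat \<Rightarrow> 'n mero" where
  "cC \<tau> \<tau>n \<tau>n' i = u_i \<tau>n \<tau>n' i * b_ij \<tau> 1 i * ap_ij \<tau> 1 i *
     (\<Prod>l\<in>{1..CARD('n)} - {1, i}. a_ij \<tau> i l * ap_ij \<tau> i l)"

definition cD :: "complex \<Rightarrow> complex \<Rightarrow> complex \<Rightarrow> nat \<Rightarrow> 'n mero" where
  "cD \<tau> \<tau>n \<tau>n' i = um_i \<tau>n \<tau>n' i * bp_ij \<tau> 1 i * a_ij \<tau> 1 i *
     (\<Prod>l\<in>{1..CARD('n)} - {1, i}. am_ij \<tau> l i * a_ij \<tau> l i)"

definition cB :: "complex \<Rightarrow> complex \<Rightarrow> complex \<Rightarrow> 'n mero" where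
  "cB \<tau> \<tau>n \<tau>n' = mconst (\<tau> ^ (2 * CARD('n) - 2) * \<tau>n) - cA \<tau> \<tau>n \<tau>n' -
     (\<Sum>i\<in>{1..CARD('n)} - {1}. cC \<tau> \<tau>n \<tau>n' i + cD \<tau> \<tau>n \<tau>n' i)"

definition P_elt :: "complex \<Rightarrow> complex \<Rightarrow> complex \<Rightarrow> 'n cross" where
  "P_elt \<tau> \<tau>n \<tau>n' =
     mul (cA \<tau> \<tau>n \<tau>n') \<cdot> 1 + mul (cB \<tau> \<tau>n \<tau>n') \<cdot> s_i idx 1 +
     (\<Sum>i\<in>{1..CARD('n)} - {1}.
        mul (cC \<tau> \<tau>n \<tau>n' i) \<cdot> s_ij idx 1 i + mul (cD \<tau> \<tau>n \<tau>n' i) \<cdot> sp_ij idx 1 i)"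

definition Q_elt :: "complex \<Rightarrow> complex \<Rightarrow> complex \<Rightarrow> 'n cross" where
  "Q_elt c \<tau>0 \<tau>0' =
     (mul (ut_i c \<tau>0 \<tau>0' 1) \<circ> shift c (eps idx 1)) \<cdot> 1 + mul (vt_i c \<tau>0 \<tau>0' 1) \<cdot> s_i idx 1"

end

text \<open>The index set of the primed products: those \<open>l\<close> with \<open>l - i\<close> and \<open>l - j\<close> both different from
  \<open>0, \<plusminus>n\<close>.\<close>

definition primed :: "nat \<Rightarrow> nat \<Rightarrow> nat \<Rightarrow> nat set" where
  "primed n i j = {l \<in> {1..2 * n}.
     int l - int i \<notin> {0, int n, - int n} \<and> int l - int j \<notin> {0, int n, - int n}}"

end

theory Submission
  imports Defs
begin

text \<open>An element of \<open>M'\<close> is a function on \<open>W\<close> whose value at \<open>v\<close> depends only on \<open>v\<^sup>-\<^sup>1 \<epsilon>\<^sub>1\<close>; writing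
  \<open>v\<^sup>-\<^sup>1 \<epsilon>\<^sub>i = \<epsilon>\<^bsub>\<sigma> v i\<^esub>\<close>, the \<open>r\<^sub>j\<close>-component is its value where \<open>\<sigma> v 1 = j\<close>. Both operators have the form
  \<open>\<Sum>\<^sub>i F\<^sub>1\<^sub>i r\<^sub>i\<close> for a matrix \<open>F\<close> over \<open>D\<^sub>q\<close> that is equivariant, \<open>v\<^sup>-\<^sup>1 (F\<^sub>i\<^sub>j) = F\<^bsub>\<sigma> v i, \<sigma> v j\<^esub>\<close>, and then \<open>F\<close> itself
  represents the operator. The claimed matrices are visibly equivariant, so only their first rows
  have to be compared with the coefficients \<open>A, B, C\<^sub>i, D\<^sub>i\<close>.\<close>

section \<open>Multiplicativity of the actions on meromorphic functions\<close>

lemma wact_times: "wact w (f * g) = wact w f * wact w g"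
  by transfer (auto simp: mero_rel_def intro!: exI[of _ UNIV] is_mero_mult is_mero_act)

text \<open>No meromorphy hypothesis is needed on \<open>F\<close>: the substitution is invertible,
  so \<open>F\<close> and its transform are meromorphic together, and otherwise both sides are the
  dummy 0.\<close>

lemma wact_mero_of: "wact w (mero_of F) = mero_of (\<lambda>x. F (act (inverse w) x))"
proof -
  have "is_mero F \<longleftrightarrow> is_mero (\<lambda>x. F (act (inverse w) x))"
    using is_mero_act[of F "inverse w"] is_mero_act[of "\<lambda>x. F (act (inverse w) x)" w] by auto
  then have "mero_rel (\<lambda>x. (if is_mero F then F else (\<lambda>_. 0)) (act (inverse w) x))
      (if is_mero (\<lambda>x. F (act (inverse w) x)) then (\<lambda>x. F (act (inverse w) x)) else (\<lambda>_. 0))"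
    by (cases "is_mero F") (simp_all add: mero_rel_refl is_mero_const)
  then show ?thesis
    by transfer
qed

lemma shift_mero_of: "shift c v (mero_of F) = mero_of (\<lambda>x. F (x + c *s v))"
proof -
  have "is_mero F \<longleftrightarrow> is_mero (\<lambda>x. F (x + c *s v))"
    using is_mero_translate[of F "c *s v"] is_mero_translate[of "\<lambda>x. F (x + c *s v)" "- (c *s v)"]
    by auto
  then have "mero_rel (\<lambda>x. (if is_mero F then F else (\<lambda>_. 0)) (x + c *s v))
      (if is_mero (\<lambda>x. F (x + c *s v)) then (\<lambda>x. F (x + c *s v)) else (\<lambda>_. 0))"
    by (cases "is_mero F") (simp_all add: mero_rel_refl is_mero_const)
  then show ?thesis
    by transfer
qed

lemma mero_of_cases:
  obtains F where "f = mero_of F"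
proof -
  have "\<exists>F. f = mero_of F"
    by transfer (metis mero_rel_def)
  then show thesis using that by blast
qed

lemma mconst_1: "mconst 1 = (1 :: 'n::finite mero)"
  by transfer (auto simp: is_mero_const intro!: mero_rel_refl)

lemma mconst_mult: "mconst k * mconst l = (mconst (k * l) :: 'n::finite mero)"
  by transfer (auto simp: is_mero_const intro!: mero_rel_refl)

lemma wact_mconst [simp]: "wact w (mconst k) = mconst k"
  by (simp add: wact_mero_of)

lemma wact_1 [simp]: "wact w 1 = 1"
  using wact_mconst[of w 1] by (simp only: mconst_1)

lemma wact_prod: "wact w (\<Prod>i\<in>A. f i) = (\<Prod>i\<in>A. wact w (f i))"
  by (induction A rule: infinite_finite_induct) (auto simp: wact_times)

lemma wact_minus: "wact w (f - g) = wact w f - wact w g"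
  by (metis add_diff_cancel_right' diff_add_cancel wact_add)

lemma wact_inverse_wact [simp]: "wact (inverse w) (wact w f) = f" "wact w (wact (inverse w) f) = f"
  by (simp_all flip: wact_mult)

lemma shift_times: "shift c v (f * g) = shift c v f * shift c v g"
  by transfer (auto simp: mero_rel_def intro!: exI[of _ UNIV] is_mero_mult is_mero_translate)

lemma shift_mconst: "shift c v (mconst k) = mconst k"
  by (simp add: shift_mero_of)

text \<open>Shifts fix constants, so every generator is linear over the complex numbers. This later
  moves \<kappa> past the matrix entries.\<close>

lemma Dq_mconst: "d \<in> Dq c \<Longrightarrow> d (mconst k * g) = mconst k * d g"
  by (induction d arbitrary: g rule: Dq.induct)
     (auto simp: mul_def shift_times shift_mconst algebra_simps)

section \<open>Conjugation by W and single terms of the crossed product\<close>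

lemma conj_op_mul: "conj_op w (mul f) = mul (wact w f)"
  by (simp add: conj_op_def mul_def fun_eq_iff wact_times)

text \<open>The left side evaluates the function at w (w^-1 x + c v) = x + c (w v).\<close>

lemma conj_op_shift: "conj_op w (shift c v) = shift c (act w v)"
proof
  fix f :: "'a mero"
  obtain F where "f = mero_of F" by (rule mero_of_cases)
  then show "conj_op w (shift c v) f = shift c (act w v) f"
    by (simp add: conj_op_def wact_mero_of shift_mero_of linear_add[OF act_linear] act_scale)
qed

lemma conj_op_comp: "conj_op w (d \<circ> d') = conj_op w d \<circ> conj_op w d'"
  by (simp add: conj_op_def fun_eq_iff)

lemma conj_op_0 [simp]: "conj_op w 0 = 0"
  by (simp add: conj_op_def fun_eq_iff)

lemma mul_0: "mul 0 = (0 :: 'n::finite oper)"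
  by (simp add: mul_def fun_eq_iff)

lemma mul_diff: "mul (f - g) = mul f - (mul g :: 'n::finite oper)"
  by (simp add: mul_def fun_eq_iff algebra_simps)

lemma mul_sum: "mul (\<Sum>i\<in>A. f i) = (\<Sum>i\<in>A. mul (f i) :: 'n::finite oper)"
  by (simp add: mul_def fun_eq_iff sum_fun_apply sum_distrib_right)

lemma Dq_0: "(0 :: 'n::finite oper) \<in> Dq c"
  using Dq.mul[of 0 c] by (simp add: mul_0)

lemma zero_term_of [simp]: "0 \<cdot> w = 0"
  by (simp add: term_of_def fun_eq_iff)

lemma cross_act_add: "cross_act (Y + Z) m = cross_act Y m + cross_act Z m"
  by (simp add: cross_act_def fun_eq_iff conj_op_def wact_add sum.distrib)

lemma cross_act_zero: "cross_act 0 m = 0"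
  by (simp add: cross_act_def fun_eq_iff)

lemma cross_act_sum: "cross_act (\<Sum>i\<in>A. Z i) m = (\<Sum>i\<in>A. cross_act (Z i) m)"
  by (induction A rule: infinite_finite_induct)
     (simp_all only: cross_act_add cross_act_zero sum.infinite sum.empty sum.insert if_False not_False_eq_True)

lemma cross_act_term_of: "cross_act (d \<cdot> w) m v = conj_op (inverse v) d (m (inverse w * v))"
proof -
  have "conj_op (inverse v) ((d \<cdot> w) t) (m (inverse t * v)) =
      (if t = w then conj_op (inverse v) d (m (inverse w * v)) else 0)" for t
    by (auto simp: term_of_def)
  then show ?thesis by (simp add: cross_act_def)
qed

lemma DqW_sum_term_of:
  assumes "finite A" "\<And>i. i \<in> A \<Longrightarrow> d i \<in> Dq c"
  shows "(\<Sum>i\<in>A. d i \<cdot> w i) \<in> DqW c"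
  using assms
  by (induction A rule: finite_induct) (auto simp: DqW_def term_of_def Dq_0 intro!: Dq.add)


section \<open>The action of W on the extended coordinates\<close>

locale coord_enum =
  fixes idx :: "nat \<Rightarrow> 'n::finite" and n :: nat
  assumes n [simp]: "CARD('n) = n"
    and idx: "bij_betw idx {1..n} UNIV"
begin

definition I :: "nat set" where "I = {1..2 * n}"

lemma I_iff: "i \<in> I \<longleftrightarrow> 1 \<le> i \<and> i \<le> 2 * n"
  by (auto simp: I_def)

lemma finite_I [simp]: "finite I"
  by (simp add: I_def)

text \<open>The index of the opposite vector. The condition i - j = n or -n becomes
  \<open>j = opp i\<close>, a form that is stable under W.\<close>

definition opp :: "nat \<Rightarrow> nat" where
  "opp i = (if i \<le> n then i + n else i - n)"

lemma card_pos: "n \<ge> 1"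
  using zero_less_card_finite[where 'a = 'n] by simp

lemma opp_in [simp]: "i \<in> I \<Longrightarrow> opp i \<in> I"
  and opp_opp [simp]: "i \<in> I \<Longrightarrow> opp (opp i) = i"
  and opp_neq: "i \<in> I \<Longrightarrow> opp i \<noteq> i"
  by (auto simp: opp_def I_iff)

declare One_nat_def [simp del]

lemma one_in [simp]: "1 \<in> I"
  using card_pos by (simp add: I_iff)

lemma eps_opp: "i \<in> I \<Longrightarrow> eps idx (opp i) = - eps idx i"
  and xc_opp: "i \<in> I \<Longrightarrow> xc idx (opp i) x = - xc idx i x"
  by (auto simp: opp_def eps_def xc_def I_iff)

lemma diff_pm_iff: "i \<in> I \<Longrightarrow> j \<in> I \<Longrightarrow>
    int i - int j \<in> {int n, - int n} \<longleftrightarrow> j = opp i"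
  and diff_iff: "i \<in> I \<Longrightarrow> j \<in> I \<Longrightarrow>
    int i - int j \<in> {0, int n, - int n} \<longleftrightarrow> j = i \<or> j = opp i"
  by (auto simp: opp_def I_iff)

text \<open>The coordinate functions separate the vectors: the j-th one is 1 on the j-th vector, -1
  on its opposite and 0 on the rest.\<close>

lemma eps_eq_iff:
  assumes ij: "i \<in> I" "j \<in> I"
  shows "eps idx i = eps idx j \<longleftrightarrow> i = j"
proof
  assume eq: "eps idx i = eps idx j"
  have xc0: "xc idx k 0 = 0" for k by (simp add: xc_def)
  have 1: "xc idx k (eps idx k) = 1" if "k \<in> I" for k
    using xc_eps(1)[OF idx[folded n] that[unfolded I_def, folded n] that[unfolded I_def, folded n], of 0 1] by (simp add: xc0)
  show "i = j"
  proof (rule ccontr)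
    assume "i \<noteq> j"
    moreover have "j \<noteq> opp i" using eq xc_opp[of i "eps idx i"] 1[of i] 1[of j] ij by auto
    ultimately have "xc idx j (0 + 1 *s eps idx i) = xc idx j 0"
      by (intro xc_eps(2)[OF idx[folded n] ij[unfolded I_def, folded n]]) (simp only: n diff_iff[OF ij], simp)
    then show False using 1[OF ij(2)] eq by (simp add: xc0)
  qed
qed simp

text \<open>One index \<open>j\<close> serves vectors and coordinates at once, because a signed
  permutation matrix is orthogonal. Vectors occur in the shifts and coordinates in the coefficients,
  so both are recorded.\<close>

lemma index_exists:
  assumes i: "i \<in> I"
  shows "\<exists>j\<in>I. act v (eps idx j) = eps idx i \<and> (\<forall>x. xc idx i (act v x) = xc idx j x)"
proof -
  obtain p s where p: "bij p" and s: "\<forall>k. s k \<in> {1, -1}" and v: "act v = (\<lambda>x. \<chi> k. s k * x $ p k)"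
    using act[of v] by blast
  have *: "\<exists>j\<in>I. act v (eps idx j) = eps idx i \<and> (\<forall>x. xc idx i (act v x) = xc idx j x)"
    if i: "i \<in> {1..n}" for i
  proof -
    have "p (idx i) \<in> idx ` {1..n}" using idx by (simp add: bij_betw_def)
    then obtain j where j: "j \<in> {1..n}" "idx j = p (idx i)" by auto
    have pp: "p k = p l \<longleftrightarrow> k = l" for k l using p by (metis bij_pointE)
    show ?thesis
    \<comment> \<open>The sign of the matrix entry decides between \<open>j\<close> and its opposite
      \<open>j + n\<close>.\<close>
    proof (cases "s (idx i) = 1")
      case True
      then show ?thesis using i j
        by (intro bexI[of _ j]) (auto simp: I_iff v eps_def xc_def axis_def vec_eq_iff pp)
    next
      case False
      then have "s (idx i) = -1" using s by blast
      then show ?thesis using i j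
        by (intro bexI[of _ "j + n"]) (auto simp: I_iff v eps_def xc_def axis_def vec_eq_iff pp)
    qed
  qed
  show ?thesis
  proof (cases "i \<le> n")
    case True
    then show ?thesis using * i by (simp add: I_iff)
  next
    case False
    then have "opp i \<in> {1..n}" using i by (auto simp: I_iff opp_def)
    from *[OF this] obtain j where "j \<in> I" "act v (eps idx j) = - eps idx i"
      "\<forall>x. - xc idx i (act v x) = xc idx j x"
      using i by (auto simp: eps_opp xc_opp)
    then show ?thesis
      by (intro bexI[of _ "opp j"])
         (auto simp: eps_opp xc_opp linear_neg[OF act_linear] minus_equation_iff)
  qed
qed

text \<open>The inverse of \<open>v\<close> is used because \<open>cross_act\<close> twists the
  coefficient at \<open>v\<close> by \<open>conj_op (inverse v)\<close>. The chosen index is unique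
  by \<open>eps_eq_iff\<close>.\<close>

definition \<sigma> :: "'n sperm \<Rightarrow> nat \<Rightarrow> nat" where
  "\<sigma> v i = (SOME j. j \<in> I \<and> act v (eps idx j) = eps idx i \<and> (\<forall>x. xc idx i (act v x) = xc idx j x))"

lemma \<sigma>:
  assumes "i \<in> I"
  shows \<sigma>_in [simp]: "\<sigma> v i \<in> I"
    and act_eps_\<sigma>: "act v (eps idx (\<sigma> v i)) = eps idx i"
    and xc_act: "xc idx i (act v x) = xc idx (\<sigma> v i) x"
proof -
  have "\<exists>j. j \<in> I \<and> act v (eps idx j) = eps idx i \<and> (\<forall>x. xc idx i (act v x) = xc idx j x)"
    using index_exists[OF assms, of v] by blast
  from someI_ex[OF this, folded \<sigma>_def]
  show "\<sigma> v i \<in> I" "act v (eps idx (\<sigma> v i)) = eps idx i" "xc idx i (act v x) = xc idx (\<sigma> v i) x"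
    by blast+
qed

lemma \<sigma>_eqI:
  assumes "i \<in> I" "j \<in> I" "act v (eps idx j) = eps idx i"
  shows "\<sigma> v i = j"
proof -
  have "act v (eps idx (\<sigma> v i)) = act v (eps idx j)" using assms by (simp add: act_eps_\<sigma>)
  then have "eps idx (\<sigma> v i) = eps idx j" by (metis act_inverse_left)
  then show ?thesis using assms \<sigma>_in[of i v] eps_eq_iff by blast
qed

lemma \<sigma>_eq_iff: "i \<in> I \<Longrightarrow> j \<in> I \<Longrightarrow> \<sigma> v i = \<sigma> v j \<longleftrightarrow> i = j"
  by (metis act_eps_\<sigma> eps_eq_iff)

lemma \<sigma>_opp: "i \<in> I \<Longrightarrow> \<sigma> v (opp i) = opp (\<sigma> v i)"
  by (rule \<sigma>_eqI) (simp_all add: eps_opp linear_neg[OF act_linear] act_eps_\<sigma>)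

lemma \<sigma>_bij: "bij_betw (\<sigma> v) I I"
proof -
  have inj: "inj_on (\<sigma> v) I" by (auto intro!: inj_onI simp: \<sigma>_eq_iff)
  then show ?thesis
    by (simp add: bij_betw_def endo_inj_surj image_subsetI)
qed

lemma act_inverse_eps: "i \<in> I \<Longrightarrow> act (inverse v) (eps idx i) = eps idx (\<sigma> v i)"
  by (metis act_eps_\<sigma> act_inverse_left)

text \<open>Each representative exchanges the first vector with the i-th one; hence these elements
  lie in pairwise distinct cosets of the stabiliser.\<close>

lemma act_rep:
  assumes i: "i \<in> I"
  shows "act (rep idx i) (eps idx 1) = eps idx i" and "act (rep idx i) (eps idx i) = eps idx 1"
proof -
  have inj: "idx k = idx l \<longleftrightarrow> k = l" if "k \<in> {1..n}" "l \<in> {1..n}" for k l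
    using that idx unfolding bij_betw_def inj_on_def by blast
  have "act (rep idx i) (eps idx 1) = eps idx i \<and> act (rep idx i) (eps idx i) = eps idx 1"
  proof (cases "i = 1 \<or> i = n + 1")
    case True
    then show ?thesis using card_pos
      by (auto simp: rep_def eps_def s_i_def flip.rep_eq axis_def vec_eq_iff)
  next
    case False
    \<comment> \<open>The index of the underlying coordinate, with the sign forgotten.\<close>
    define k where "k = (if i \<le> n then i else i - n)"
    have k: "k \<in> {1..n}" "k \<noteq> 1" "i = k \<or> i = k + n"
      using False i by (auto simp: k_def I_iff)
    have ne: "idx 1 \<noteq> idx k" using inj[of 1 k] k by auto
    have "eps idx 1 = axis (idx 1) 1" using card_pos by (simp add: eps_def)
    moreover have "act (swap (idx 1) (idx k)) (axis (idx 1) 1) = axis (idx k) 1"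
      "act (swap (idx 1) (idx k)) (axis (idx k) 1) = axis (idx 1) 1"
      using ne by (auto simp: swap.rep_eq axis_def vec_eq_iff)
    moreover have "act (flip (idx 1)) (axis (idx 1) 1) = - axis (idx 1) 1"
      "act (flip (idx k)) (axis (idx 1) 1) = axis (idx 1) 1"
      "act (flip (idx 1)) (axis (idx k) 1) = axis (idx k) 1"
      "act (flip (idx k)) (axis (idx k) 1) = - axis (idx k) 1"
      using ne by (auto simp: flip.rep_eq axis_def vec_eq_iff)
    ultimately show ?thesis using k False
      by (auto simp: rep_def eps_def s_ij_def sp_ij_def s_i_def linear_neg[OF act_linear])
  qed
  then show "act (rep idx i) (eps idx 1) = eps idx i" "act (rep idx i) (eps idx i) = eps idx 1"
    by blast+
qed


section \<open>Matrices representing elements of the crossed product\<close>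

definition \<kappa> :: "'n mero" where
  "\<kappa> = mconst (1 / of_nat (card (stab1 idx)))"

lemma stab1_iff: "w \<in> stab1 idx \<longleftrightarrow> act w (eps idx 1) = eps idx 1"
  using card_pos by (simp add: stab1_def eps_def)

text \<open>The stabiliser contains 1, so its order is a nonzero constant, and multiplying by that
  constant inverts \<kappa>.\<close>

lemma \<kappa>_cancel: "\<kappa> * f = \<kappa> * g \<longleftrightarrow> f = g"
proof -
  have "1 \<in> stab1 idx" by (simp add: stab1_def)
  then have "card (stab1 idx) \<noteq> 0" by auto
  then have "mconst (of_nat (card (stab1 idx))) * \<kappa> = 1"
    by (simp add: \<kappa>_def mconst_mult mconst_1)
  then show ?thesis by (metis mult.assoc mult_1_left)
qed

lemma cross_act_e': "cross_act (e' idx) m v = \<kappa> * (\<Sum>w\<in>stab1 idx. m (inverse w * v))"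
proof -
  have "cross_act (e' idx) m v = (\<Sum>w\<in>stab1 idx. mul \<kappa> (m (inverse w * v)))"
    by (simp add: e'_def cross_act_sum sum_fun_apply cross_act_term_of conj_op_mul \<kappa>_def)
  then show ?thesis by (simp add: mul_def sum_distrib_left)
qed

text \<open>Only w = v r_i^-1 can contribute to the average, and it lies in the stabiliser exactly
  when v maps the i-th vector to the first. Thus e' r_i f is \<kappa> f spread over one
  coset.\<close>

lemma er_apply:
  assumes i: "i \<in> I"
  shows "er idx i f v = (if \<sigma> v 1 = i then \<kappa> * f else 0)"
proof -
  have eq: "inverse w * v = rep idx i \<longleftrightarrow> v * inverse (rep idx i) = w" for w
  proof
    assume "inverse w * v = rep idx i"
    then have "rep idx i = inverse w * v" by simp
    then show "v * inverse (rep idx i) = w"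
      by (simp add: sperm_inverse_mult flip: mult.assoc)
  next
    assume "v * inverse (rep idx i) = w"
    then have "w = v * inverse (rep idx i)" by simp
    then show "inverse w * v = rep idx i"
      by (simp add: sperm_inverse_mult mult.assoc)
  qed
  have "act (inverse (rep idx i)) (eps idx 1) = eps idx i"
    by (metis act_rep(2)[OF i] act_inverse_left)
  then have "v * inverse (rep idx i) \<in> stab1 idx \<longleftrightarrow> \<sigma> v 1 = i"
    using \<sigma>_eqI[OF one_in i] act_eps_\<sigma>[OF one_in, of v] by (auto simp: stab1_iff)
  then show ?thesis
    by (simp add: er_def cross_act_e' elt_def eq)
qed

lemma sum_er_apply: "(\<Sum>i\<in>I. er idx i (f i)) v = \<kappa> * f (\<sigma> v 1)"
  by (simp add: sum_fun_apply er_apply one_in)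

text \<open>Averaging makes the value at v depend only on the coset W'v, that is, on
  \<open>\<sigma> v 1\<close>; the coset sums are then the components. The converse is additivity of
  the action of e'.\<close>

lemma M'_eq: "M' idx = range (\<lambda>f. \<Sum>i\<in>I. er idx i (f i))"
proof (intro equalityI subsetI)
  fix m assume "m \<in> M' idx"
  then obtain m0 where m: "m = cross_act (e' idx) m0" by (auto simp: M'_def)
  have "m v = \<kappa> * (\<Sum>t | \<sigma> t 1 = \<sigma> v 1. m0 t)" for v
  proof -
    have "(\<Sum>w\<in>stab1 idx. m0 (inverse w * v)) = (\<Sum>t | \<sigma> t 1 = \<sigma> v 1. m0 t)"
    \<comment> \<open>The map from w to w^-1 v carries W' onto the coset W'v.\<close>
    proof (rule sum.reindex_bij_witness[of _ "\<lambda>t. v * inverse t" "\<lambda>w. inverse w * v"])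
      fix w assume "w \<in> stab1 idx"
      then have "act (inverse w) (eps idx 1) = eps idx 1"
        by (metis stab1_iff act_inverse_left)
      then show "inverse w * v \<in> {t. \<sigma> t 1 = \<sigma> v 1}"
        by (auto intro!: \<sigma>_eqI simp: one_in act_eps_\<sigma>)
    next
      fix t assume "t \<in> {t. \<sigma> t 1 = \<sigma> v 1}"
      then show "v * inverse t \<in> stab1 idx"
        by (simp add: stab1_iff act_inverse_eps one_in act_eps_\<sigma>)
    qed (simp_all add: sperm_inverse_mult mult.assoc, simp flip: mult.assoc)
    then show ?thesis by (simp add: m cross_act_e')
  qed
  then have "m = (\<Sum>i\<in>I. er idx i (\<Sum>t | \<sigma> t 1 = i. m0 t))"
    by (simp only: fun_eq_iff sum_er_apply simp_thms)
  then show "m \<in> range (\<lambda>f. \<Sum>i\<in>I. er idx i (f i))"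
    by (rule range_eqI[where x = "\<lambda>i. \<Sum>t | \<sigma> t 1 = i. m0 t"])
next
  fix m assume "m \<in> range (\<lambda>f. \<Sum>i\<in>I. er idx i (f i))"
  then obtain f where "m = (\<Sum>i\<in>I. er idx i (f i))" by blast
  then have m: "m v = (\<Sum>i\<in>I. \<kappa> * (\<Sum>w\<in>stab1 idx. elt (rep idx i) (f i) (inverse w * v)))" for v
    by (simp only: sum_fun_apply er_def cross_act_e')
  have "m v = \<kappa> * (\<Sum>w\<in>stab1 idx. \<Sum>i\<in>I. elt (rep idx i) (f i) (inverse w * v))" for v
    unfolding m by (simp only: sum_distrib_left[symmetric]) (subst sum.swap, rule refl)
  then have "m = cross_act (e' idx) (\<Sum>i\<in>I. elt (rep idx i) (f i))"
    by (simp only: fun_eq_iff sum_fun_apply cross_act_e' simp_thms)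
  then show "m \<in> M' idx" by (simp add: M'_def)
qed

text \<open>At \<open>v\<close> the action conjugates the first row of \<open>F\<close> by v^-1;
  equivariance turns this into row \<open>\<sigma> v 1\<close>, which is the index of the component
  seen at \<open>v\<close>.\<close>

lemma represents_equivariant:
  assumes Dq: "\<And>i j. i \<in> I \<Longrightarrow> j \<in> I \<Longrightarrow> F i j \<in> Dq c"
    and equiv: "\<And>v i j. i \<in> I \<Longrightarrow> j \<in> I \<Longrightarrow> conj_op (inverse v) (F i j) = F (\<sigma> v i) (\<sigma> v j)"
  shows "represents c idx (\<Sum>i\<in>I. F 1 i \<cdot> rep idx i) F"
proof -
  let ?Z = "\<Sum>i\<in>I. F 1 i \<cdot> rep idx i"
  have key: "cross_act ?Z (\<Sum>j\<in>I. er idx j (f j)) = (\<Sum>k\<in>I. er idx k (\<Sum>j\<in>I. F k j (f j)))" for f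
  proof
    fix v
    \<comment> \<open>Here (r_i^-1 v)^-1 maps the first vector to v^-1 r_i of it, which is v^-1 of
      the i-th vector.\<close>
    have \<sigma>_rep: "\<sigma> (inverse (rep idx i) * v) 1 = \<sigma> v i" if i: "i \<in> I" for i
    proof -
      have "act (inverse (rep idx i)) (eps idx i) = eps idx 1"
        by (metis act_rep(1)[OF i] act_inverse_left)
      then show ?thesis by (auto intro!: \<sigma>_eqI simp: one_in act_eps_\<sigma> i)
    qed
    have "cross_act ?Z (\<Sum>j\<in>I. er idx j (f j)) v =
        (\<Sum>i\<in>I. conj_op (inverse v) (F 1 i) (\<kappa> * f (\<sigma> (inverse (rep idx i) * v) 1)))"
      by (simp only: cross_act_sum sum_fun_apply[of _ I v] cross_act_term_of sum_er_apply)
    also have "\<dots> = (\<Sum>i\<in>I. F (\<sigma> v 1) (\<sigma> v i) (\<kappa> * f (\<sigma> v i)))"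
      by (simp add: \<sigma>_rep equiv one_in)
    \<comment> \<open>The index permutation of \<open>v\<close> only reorders the columns.\<close>
    also have "\<dots> = (\<Sum>j\<in>I. F (\<sigma> v 1) j (\<kappa> * f j))"
      by (rule sum.reindex_bij_betw[OF \<sigma>_bij])
    also have "\<dots> = \<kappa> * (\<Sum>j\<in>I. F (\<sigma> v 1) j (f j))"
      unfolding sum_distrib_left \<kappa>_def
      by (intro sum.cong refl Dq_mconst[where c = c] Dq \<sigma>_in one_in)
    also have "\<dots> = (\<Sum>k\<in>I. er idx k (\<Sum>j\<in>I. F k j (f j))) v"
      by (simp add: sum_er_apply)
    finally show "cross_act ?Z (\<Sum>j\<in>I. er idx j (f j)) v =
      (\<Sum>k\<in>I. er idx k (\<Sum>j\<in>I. F k j (f j))) v" .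
  qed
  have er_sum: "er idx k (\<Sum>j\<in>I. g j) = (\<Sum>j\<in>I. er idx k (g j))" if "k \<in> I" for k g
    by (simp add: fun_eq_iff sum_fun_apply er_apply[OF that] sum_distrib_left)
  have "?Z \<in> DqW c"
    by (intro DqW_sum_term_of Dq one_in finite_I)
  moreover have "cross_act ?Z ` M' idx \<subseteq> M' idx"
    unfolding M'_eq by (auto simp: key)
  ultimately show ?thesis
    using Dq key er_sum unfolding represents_def by (simp flip: I_def)
qed

text \<open>A vector supported in component \<open>j\<close> selects the column, and evaluation at
  r_i selects the row. This carries the explicit matrices over to every representing matrix.\<close>

lemma represents_unique:
  assumes P: "represents c idx Z P" and P': "represents c idx Z P'" and ij: "i \<in> I" "j \<in> I"
  shows "P i j = P' i j"
proof
  fix g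
  define f :: "nat \<Rightarrow> 'n mero" where "f = (\<lambda>l. if l = j then g else 0)"
  have \<sigma>_rep: "\<sigma> (rep idx i) 1 = i"
    by (intro \<sigma>_eqI one_in ij act_rep)
  have "cross_act Z (\<Sum>l\<in>I. er idx l (f l)) (rep idx i) = \<kappa> * R i j g" if R: "represents c idx Z R" for R
  proof -
    \<comment> \<open>The entries lie in \<open>Dq c\<close> and are therefore additive, so the
      other columns contribute nothing.\<close>
    have R0: "R i l 0 = 0" if "l \<in> I" for l
      using R ij that unfolding represents_def by (intro Dq_zero[of _ c]) (simp flip: I_def)
    have "cross_act Z (\<Sum>l\<in>I. er idx l (f l)) = (\<Sum>k\<in>I. \<Sum>l\<in>I. er idx k (R k l (f l)))"
      using R unfolding represents_def by (simp flip: I_def)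
    then have "cross_act Z (\<Sum>l\<in>I. er idx l (f l)) (rep idx i) =
        (\<Sum>l\<in>I. \<Sum>k\<in>I. er idx k (R k l (f l)) (rep idx i))"
      by (subst sum.swap) (simp add: sum_fun_apply)
    also have "\<dots> = (\<Sum>l\<in>I. if l = j then \<kappa> * R i l g else 0)"
      by (intro sum.cong refl) (simp add: er_apply \<sigma>_rep ij f_def R0)
    finally show ?thesis using ij by simp
  qed
  from this[OF P] this[OF P'] show "P i j g = P' i j g" by (simp add: \<kappa>_cancel)
qed


section \<open>The matrices of P and Q\<close>

lemma I_eq: "I = insert 1 (insert (n + 1) (({1..n} - {1}) \<union> (\<lambda>l. l + n) ` ({1..n} - {1})))"
  (is "_ = ?R")
proof (rule set_eqI)
  fix i
  have "i \<in> (\<lambda>l. l + n) ` ({1..n} - {1}) \<longleftrightarrow> i > n + 1 \<and> i \<le> 2 * n"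
    by (auto intro!: image_eqI[of _ _ "i - n"])
  then show "i \<in> I \<longleftrightarrow> i \<in> ?R"
    using card_pos by (auto simp: I_iff)
qed

lemma primed_eq:
  assumes "i \<in> I" "j \<in> I"
  shows "primed n i j = I - {i, opp i, j, opp j}"
proof -
  have "int l - int k \<in> {0, int n, - int n} \<longleftrightarrow> l \<in> {k, opp k}" if "l \<in> I" "k \<in> I" for k l
    using diff_iff[OF that] that by (metis insert_iff opp_opp singletonD)
  then show ?thesis
    using assms unfolding primed_def I_def[symmetric] by blast
qed

lemma primed_opp: "i \<in> I \<Longrightarrow> j \<in> I \<Longrightarrow> primed n i (opp j) = primed n i j"
  by (auto simp: primed_eq)

lemma primed_1:
  assumes "i \<in> {1..n}"
  shows "primed n 1 i = ({1..n} - {1, i}) \<union> (\<lambda>l. l + n) ` ({1..n} - {1, i})"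
proof -
  have "l \<in> (\<lambda>l. l + n) ` ({1..n} - {1, i}) \<longleftrightarrow> l > n + 1 \<and> l \<le> 2 * n \<and> l \<noteq> i + n" for l
    by (auto intro!: image_eqI[of _ _ "l - n"])
  moreover have "i \<in> I" "opp i = i + n" "opp 1 = n + 1"
    using assms card_pos by (simp_all add: I_iff opp_def)
  ultimately show ?thesis using assms
    by (auto simp: primed_eq I_iff)
qed

text \<open>Pairing \<open>l\<close> with \<open>l + n\<close> matches the primed products with the
  paired factors in A, C_i and D_i; the case \<open>i = 1\<close> serves A.\<close>

lemma prod_primed_1:
  assumes "i \<in> {1..n}"
  shows "(\<Prod>l\<in>primed n 1 i. g l) = (\<Prod>l\<in>{1..n} - {1, i}. g l * g (l + n))"
  unfolding primed_1[OF assms]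
  by (subst prod.union_disjoint) (auto simp: prod.reindex prod.distrib)

lemma sum_I:
  fixes g :: "nat \<Rightarrow> 'b::comm_monoid_add"
  shows "(\<Sum>i\<in>I. g i) = g 1 + g (n + 1) + (\<Sum>i\<in>{1..n} - {1}. g i + g (i + n))"
proof -
  have "(\<Sum>i\<in>({1..n} - {1}) \<union> (\<lambda>l. l + n) ` ({1..n} - {1}). g i) = (\<Sum>i\<in>{1..n} - {1}. g i + g (i + n))"
    by (subst sum.union_disjoint) (auto simp: sum.reindex sum.distrib)
  moreover have "1 \<notin> insert (n + 1) (({1..n} - {1}) \<union> (\<lambda>l. l + n) ` ({1..n} - {1}))"
    "n + 1 \<notin> ({1..n} - {1}) \<union> (\<lambda>l. l + n) ` ({1..n} - {1})"
    using card_pos by auto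
  ultimately show ?thesis
    unfolding I_eq by (simp add: add.assoc)
qed

text \<open>The index permutation commutes with \<open>opp\<close>, so it carries the excluded
  indices to the excluded indices.\<close>

lemma \<sigma>_primed:
  assumes "i \<in> I" "j \<in> I"
  shows "bij_betw (\<sigma> v) (primed n i j) (primed n (\<sigma> v i) (\<sigma> v j))"
proof -
  have "bij_betw (\<sigma> v) {i, opp i, j, opp j} {\<sigma> v i, opp (\<sigma> v i), \<sigma> v j, opp (\<sigma> v j)}"
    using assms by (intro bij_betw_imageI inj_onI) (auto simp: \<sigma>_eq_iff \<sigma>_opp[symmetric])
  from bij_betw_DiffI[OF \<sigma>_bij this] show ?thesis
    using assms by (simp add: primed_eq)
qed

section \<open>Equivariance of the coefficients and matrices\<close>

lemma ap_ij_eq: "j \<in> I \<Longrightarrow> ap_ij idx \<tau> i j = a_ij idx \<tau> i (opp j)"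
  by (simp add: ap_ij_def a_ij_def xc_opp)

lemma
  assumes "i \<in> I" "j \<in> I"
  shows wact_a_ij: "wact (inverse v) (a_ij idx \<tau> i j) = a_ij idx \<tau> (\<sigma> v i) (\<sigma> v j)"
    and wact_ap_ij: "wact (inverse v) (ap_ij idx \<tau> i j) = ap_ij idx \<tau> (\<sigma> v i) (\<sigma> v j)"
    and wact_b_ij: "wact (inverse v) (b_ij idx \<tau> i j) = b_ij idx \<tau> (\<sigma> v i) (\<sigma> v j)"
  using assms by (simp_all add: a_ij_def ap_ij_def b_ij_def wact_mero_of xc_act)

lemma
  assumes "i \<in> I"
  shows wact_u_i: "wact (inverse v) (u_i idx \<tau>n \<tau>n' i) = u_i idx \<tau>n \<tau>n' (\<sigma> v i)"
    and wact_ut_i: "wact (inverse v) (ut_i idx c \<tau>0 \<tau>0' i) = ut_i idx c \<tau>0 \<tau>0' (\<sigma> v i)"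
    and wact_vt_i: "wact (inverse v) (vt_i idx c \<tau>0 \<tau>0' i) = vt_i idx c \<tau>0 \<tau>0' (\<sigma> v i)"
  using assms by (simp_all add: u_i_def ut_i_def vt_i_def wact_mero_of xc_act)

text \<open>The entries of \<open>P\<close> off the positions \<open>i - j = \<plusminus>n\<close>.\<close>

definition P_off :: "complex \<Rightarrow> complex \<Rightarrow> complex \<Rightarrow> nat \<Rightarrow> nat \<Rightarrow> 'n mero" where
  "P_off \<tau> \<tau>n \<tau>n' i j =
     (if j = i then u_i idx \<tau>n \<tau>n' i * (\<Prod>l\<in>primed n i i. a_ij idx \<tau> i l)
      else u_i idx \<tau>n \<tau>n' j * b_ij idx \<tau> i j * ap_ij idx \<tau> i j * (\<Prod>l\<in>primed n i j. a_ij idx \<tau> j l))"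

text \<open>The row sum runs over \<open>P_off\<close>, which avoids recursion; for
  \<open>j = opp i\<close> its range omits the one column where the two could differ.\<close>

definition P_coeff :: "complex \<Rightarrow> complex \<Rightarrow> complex \<Rightarrow> nat \<Rightarrow> nat \<Rightarrow> 'n mero" where
  "P_coeff \<tau> \<tau>n \<tau>n' i j =
     (if j = opp i then mconst (\<tau> ^ (2 * n - 2) * \<tau>n) - (\<Sum>l\<in>I - {j}. P_off \<tau> \<tau>n \<tau>n' i l)
      else P_off \<tau> \<tau>n \<tau>n' i j)"

definition Q_mat :: "complex \<Rightarrow> complex \<Rightarrow> complex \<Rightarrow> nat \<Rightarrow> nat \<Rightarrow> 'n oper" where
  "Q_mat c \<tau>0 \<tau>0' i j =
     (if j = i then mul (ut_i idx c \<tau>0 \<tau>0' j) \<circ> shift c (eps idx j)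
      else if j = opp i then mul (vt_i idx c \<tau>0 \<tau>0' i) else 0)"

lemma wact_P_off:
  assumes ij: "i \<in> I" "j \<in> I"
  shows "wact (inverse v) (P_off \<tau> \<tau>n \<tau>n' i j) = P_off \<tau> \<tau>n \<tau>n' (\<sigma> v i) (\<sigma> v j)"
proof -
  have "wact (inverse v) (\<Prod>l\<in>primed n i j. a_ij idx \<tau> j l) =
      (\<Prod>l\<in>primed n (\<sigma> v i) (\<sigma> v j). a_ij idx \<tau> (\<sigma> v j) l)" if "i \<in> I" "j \<in> I" for i j
  proof -
    have "wact (inverse v) (\<Prod>l\<in>primed n i j. a_ij idx \<tau> j l) =
        (\<Prod>l\<in>primed n i j. a_ij idx \<tau> (\<sigma> v j) (\<sigma> v l))"
      unfolding wact_prod using that by (intro prod.cong refl wact_a_ij) (auto simp: primed_eq)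
    then show ?thesis
      using prod.reindex_bij_betw[OF \<sigma>_primed[OF that]] by simp
  qed
  then show ?thesis
    using ij by (simp add: P_off_def wact_times wact_u_i wact_b_ij wact_ap_ij \<sigma>_eq_iff)
qed

text \<open>In the opposite position the constant is W-invariant and the remaining columns are
  permuted among themselves.\<close>

lemma wact_P_coeff:
  assumes ij: "i \<in> I" "j \<in> I"
  shows "wact (inverse v) (P_coeff \<tau> \<tau>n \<tau>n' i j) = P_coeff \<tau> \<tau>n \<tau>n' (\<sigma> v i) (\<sigma> v j)"
proof -
  have "bij_betw (\<sigma> v) {j} {\<sigma> v j}" by (simp add: bij_betw_def)
  then have bij: "bij_betw (\<sigma> v) (I - {j}) (I - {\<sigma> v j})"
    using bij_betw_DiffI[OF \<sigma>_bij] ij by simp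
  have "(\<Sum>l\<in>I - {j}. wact (inverse v) (P_off \<tau> \<tau>n \<tau>n' i l)) =
      (\<Sum>l\<in>I - {j}. P_off \<tau> \<tau>n \<tau>n' (\<sigma> v i) (\<sigma> v l))"
    using ij by (intro sum.cong refl wact_P_off) auto
  also have "\<dots> = (\<Sum>l\<in>I - {\<sigma> v j}. P_off \<tau> \<tau>n \<tau>n' (\<sigma> v i) l)"
    by (rule sum.reindex_bij_betw[OF bij])
  finally show ?thesis
    unfolding P_coeff_def using ij
    by (simp only: \<sigma>_opp[symmetric] \<sigma>_eq_iff opp_in if_distrib[of "wact (inverse v)"]
        wact_minus wact_mconst wact_sum wact_P_off)
qed

lemma conj_op_Q_mat:
  assumes ij: "i \<in> I" "j \<in> I"
  shows "conj_op (inverse v) (Q_mat c \<tau>0 \<tau>0' i j) = Q_mat c \<tau>0 \<tau>0' (\<sigma> v i) (\<sigma> v j)"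
  using ij by (simp add: Q_mat_def conj_op_comp conj_op_mul conj_op_shift wact_ut_i wact_vt_i
      act_inverse_eps \<sigma>_eq_iff \<sigma>_opp[symmetric])

lemma Q_mat_Dq:
  assumes "i \<in> I" "j \<in> I"
  shows "Q_mat c \<tau>0 \<tau>0' i j \<in> Dq c"
proof -
  have "eps idx j \<in> lattice" by (simp add: lattice_def eps_def axis_def)
  then have "mul (ut_i idx c \<tau>0 \<tau>0' j) \<circ> shift c (eps idx j) \<in> Dq c"
    by (intro Dq.comp Dq.mul Dq.shift)
  then show ?thesis by (cases "j = i") (simp_all add: Q_mat_def Dq_0 Dq.mul)
qed

section \<open>Comparison of the first rows with A, B, C_i, D_i\<close>

lemma rep_simps:
  shows "rep idx 1 = 1" and "rep idx (n + 1) = s_i idx 1"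
    and "i \<in> {1..n} - {1} \<Longrightarrow> rep idx i = s_ij idx 1 i"
    and "i \<in> {1..n} - {1} \<Longrightarrow> rep idx (i + n) = sp_ij idx 1 i"
  using card_pos by (auto simp: rep_def)

lemma opp_1: "opp 1 = n + 1"
  using card_pos by (simp add: opp_def)

lemma cA_eq: "cA idx \<tau> \<tau>n \<tau>n' = P_off \<tau> \<tau>n \<tau>n' 1 1"
proof -
  have "(\<Prod>l\<in>{1..n} - {1}. a_ij idx \<tau> 1 l * ap_ij idx \<tau> 1 l) =
      (\<Prod>l\<in>{1..n} - {1}. a_ij idx \<tau> 1 l * a_ij idx \<tau> 1 (l + n))"
    by (intro prod.cong) (auto simp: ap_ij_eq I_iff opp_def)
  then show ?thesis
    using card_pos by (simp add: cA_def P_off_def prod_primed_1)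
qed

text \<open>D_i is the expression for C_i at the opposite index: substituting -x_i for x_i turns the
  factors of one into those of the other, and the primed index set does not change.\<close>

lemma
  assumes i: "i \<in> {1..n} - {1}"
  shows cC_eq: "cC idx \<tau> \<tau>n \<tau>n' i = P_off \<tau> \<tau>n \<tau>n' 1 i"
    and cD_eq: "cD idx \<tau> \<tau>n \<tau>n' i = P_off \<tau> \<tau>n \<tau>n' 1 (i + n)"
proof -
  have iI: "i \<in> I" and opp_i: "i + n = opp i" using i by (auto simp: I_iff opp_def)
  have l: "l \<in> I \<and> l + n = opp l" if "l \<in> {1..n} - {1, i}" for l
    using that by (auto simp: I_iff opp_def)
  have "(\<Prod>l\<in>{1..n} - {1, i}. a_ij idx \<tau> i l * ap_ij idx \<tau> i l) =
      (\<Prod>l\<in>{1..n} - {1, i}. a_ij idx \<tau> i l * a_ij idx \<tau> i (l + n))"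
    by (intro prod.cong refl) (simp only: ap_ij_eq l)
  then show "cC idx \<tau> \<tau>n \<tau>n' i = P_off \<tau> \<tau>n \<tau>n' 1 i"
    using i by (simp add: cC_def P_off_def prod_primed_1)
  \<comment> \<open>Both equalities rewrite the argument: -(x_l + x_i) = (-x_i) - x_l and x_l - x_i
    = (-x_i) - (-x_l).\<close>
  have "am_ij idx \<tau> l i = a_ij idx \<tau> (opp i) l" "a_ij idx \<tau> l i = a_ij idx \<tau> (opp i) (opp l)"
    if "l \<in> I" for l
    using that iI
    by (simp_all only: am_ij_def a_ij_def xc_opp minus_add diff_conv_add_uminus minus_minus add.commute)
  then have "(\<Prod>l\<in>{1..n} - {1, i}. am_ij idx \<tau> l i * a_ij idx \<tau> l i) =
      (\<Prod>l\<in>{1..n} - {1, i}. a_ij idx \<tau> (opp i) l * a_ij idx \<tau> (opp i) (l + n))"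
    by (intro prod.cong refl) (simp only: l)
  moreover have "um_i idx \<tau>n \<tau>n' i = u_i idx \<tau>n \<tau>n' (opp i)" "bp_ij idx \<tau> 1 i = b_ij idx \<tau> 1 (opp i)"
    "a_ij idx \<tau> 1 i = ap_ij idx \<tau> 1 (opp i)"
    using iI by (simp_all add: um_i_def u_i_def bp_ij_def b_ij_def a_ij_def ap_ij_def xc_opp)
  moreover have "opp i \<noteq> 1" using i opp_i[symmetric] by auto
  ultimately show "cD idx \<tau> \<tau>n \<tau>n' i = P_off \<tau> \<tau>n \<tau>n' 1 (i + n)"
    using i iI unfolding opp_i
    by (simp add: cD_def P_off_def primed_opp prod_primed_1)
qed

lemma cB_eq: "cB idx \<tau> \<tau>n \<tau>n' = P_coeff \<tau> \<tau>n \<tau>n' 1 (n + 1)"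
proof -
  \<comment> \<open>Column \<open>n + 1\<close> is split off so that it cancels against the same
    term in \<open>sum_I\<close>, leaving A and the C_i, D_i.\<close>
  have "(\<Sum>l\<in>I. P_off \<tau> \<tau>n \<tau>n' 1 l) = P_off \<tau> \<tau>n \<tau>n' 1 (n + 1) + (\<Sum>l\<in>I - {n + 1}. P_off \<tau> \<tau>n \<tau>n' 1 l)"
    using card_pos by (intro sum.remove) (auto simp: I_iff)
  moreover have "(\<Sum>i\<in>{1..n} - {1}. cC idx \<tau> \<tau>n \<tau>n' i + cD idx \<tau> \<tau>n \<tau>n' i) =
      (\<Sum>i\<in>{1..n} - {1}. P_off \<tau> \<tau>n \<tau>n' 1 i + P_off \<tau> \<tau>n \<tau>n' 1 (i + n))"
    by (intro sum.cong refl) (simp only: cC_eq cD_eq)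
  ultimately have "(\<Sum>l\<in>I - {n + 1}. P_off \<tau> \<tau>n \<tau>n' 1 l) =
      cA idx \<tau> \<tau>n \<tau>n' + (\<Sum>i\<in>{1..n} - {1}. cC idx \<tau> \<tau>n \<tau>n' i + cD idx \<tau> \<tau>n \<tau>n' i)"
    unfolding sum_I by (simp add: cA_eq add_ac)
  then show ?thesis
    by (simp add: cB_def P_coeff_def opp_1 diff_diff_eq)
qed

lemma P_elt_eq: "P_elt idx \<tau> \<tau>n \<tau>n' = (\<Sum>i\<in>I. mul (P_coeff \<tau> \<tau>n \<tau>n' 1 i) \<cdot> rep idx i)"
proof -
  have P: "P_coeff \<tau> \<tau>n \<tau>n' 1 i = P_off \<tau> \<tau>n \<tau>n' 1 i" if "i \<noteq> n + 1" for i
    using that by (simp add: P_coeff_def opp_1)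
  have "(\<Sum>i\<in>{1..n} - {1}. mul (cC idx \<tau> \<tau>n \<tau>n' i) \<cdot> s_ij idx 1 i + mul (cD idx \<tau> \<tau>n \<tau>n' i) \<cdot> sp_ij idx 1 i)
      = (\<Sum>i\<in>{1..n} - {1}. mul (P_coeff \<tau> \<tau>n \<tau>n' 1 i) \<cdot> rep idx i +
           mul (P_coeff \<tau> \<tau>n \<tau>n' 1 (i + n)) \<cdot> rep idx (i + n))"
  proof (rule sum.cong[OF refl])
    fix i assume i: "i \<in> {1..n} - {1}"
    \<comment> \<open>Only column \<open>n + 1\<close> is given by the row sum condition, so all
      these columns are entries of \<open>P_off\<close>.\<close>
    then have "i \<noteq> n + 1" "i + n \<noteq> n + 1" by auto
    from P[OF this(1)] P[OF this(2)] show "mul (cC idx \<tau> \<tau>n \<tau>n' i) \<cdot> s_ij idx 1 i + mul (cD idx \<tau> \<tau>n \<tau>n' i) \<cdot> sp_ij idx 1 i =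
        mul (P_coeff \<tau> \<tau>n \<tau>n' 1 i) \<cdot> rep idx i + mul (P_coeff \<tau> \<tau>n \<tau>n' 1 (i + n)) \<cdot> rep idx (i + n)"
      by (simp only: cC_eq[OF i] cD_eq[OF i] rep_simps(3,4)[OF i])
  qed
  moreover have "P_coeff \<tau> \<tau>n \<tau>n' 1 1 = P_off \<tau> \<tau>n \<tau>n' 1 1" by (rule P) (use card_pos in simp)
  ultimately show ?thesis
    unfolding sum_I P_elt_def n by (simp only: rep_simps(1,2) cA_eq cB_eq)
qed

lemma Q_elt_eq: "Q_elt idx c \<tau>0 \<tau>0' = (\<Sum>i\<in>I. Q_mat c \<tau>0 \<tau>0' 1 i \<cdot> rep idx i)"
proof -
  have "Q_mat c \<tau>0 \<tau>0' 1 i = 0 \<and> Q_mat c \<tau>0 \<tau>0' 1 (i + n) = 0" if "i \<in> {1..n} - {1}" for i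
    using that card_pos by (auto simp: Q_mat_def opp_1)
  then have "(\<Sum>i\<in>{1..n} - {1}. Q_mat c \<tau>0 \<tau>0' 1 i \<cdot> rep idx i + Q_mat c \<tau>0 \<tau>0' 1 (i + n) \<cdot> rep idx (i + n)) = 0"
    by (intro sum.neutral) (metis add_0 zero_term_of)
  moreover have "Q_mat c \<tau>0 \<tau>0' 1 1 = mul (ut_i idx c \<tau>0 \<tau>0' 1) \<circ> shift c (eps idx 1)"
    "Q_mat c \<tau>0 \<tau>0' 1 (n + 1) = mul (vt_i idx c \<tau>0 \<tau>0' 1)"
    using card_pos by (simp_all add: Q_mat_def opp_1)
  ultimately show ?thesis
    unfolding sum_I Q_elt_def by (simp only: rep_simps(1,2) add_0_right)
qed

section \<open>The representing matrices and the stated formulas\<close>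

lemma represents_P: "represents c idx (P_elt idx \<tau> \<tau>n \<tau>n') (\<lambda>i j. mul (P_coeff \<tau> \<tau>n \<tau>n' i j))"
  unfolding P_elt_eq by (rule represents_equivariant) (simp_all add: Dq.mul conj_op_mul wact_P_coeff)

lemma represents_Q: "represents c idx (Q_elt idx c \<tau>0 \<tau>0') (Q_mat c \<tau>0 \<tau>0')"
  unfolding Q_elt_eq by (rule represents_equivariant) (simp_all add: Q_mat_Dq conj_op_Q_mat)

text \<open>The row sum is restated in terms of the matrix itself, as the claim requires; away from
  \<open>opp i\<close> its entries are those of \<open>P_off\<close>.\<close>

lemma mul_P_coeff_opp:
  assumes "i \<in> I"
  shows "mul (P_coeff \<tau> \<tau>n \<tau>n' i (opp i)) =
    mul (mconst (\<tau> ^ (2 * n - 2) * \<tau>n)) - (\<Sum>l\<in>I - {opp i}. mul (P_coeff \<tau> \<tau>n \<tau>n' i l))"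
proof -
  have "(\<Sum>l\<in>I - {opp i}. mul (P_coeff \<tau> \<tau>n \<tau>n' i l)) = (\<Sum>l\<in>I - {opp i}. mul (P_off \<tau> \<tau>n \<tau>n' i l))"
    by (intro sum.cong) (auto simp: P_coeff_def)
  then show ?thesis
    unfolding P_coeff_def by (simp only: if_True refl mul_diff mul_sum)
qed

end

theorem proposition4p3:
  fixes idx :: "nat \<Rightarrow> 'n::finite"
    and c \<tau> \<tau>0 \<tau>0' \<tau>n \<tau>n' :: complex
    and n :: nat
  assumes n: "n = CARD('n)"
    and idx: "bij_betw idx {1..n} UNIV"
    and "\<tau> \<noteq> 0" "\<tau>0 \<noteq> 0" "\<tau>0' \<noteq> 0" "\<tau>n \<noteq> 0" "\<tau>n' \<noteq> 0"
  shows "(\<exists>P. represents c idx (P_elt idx \<tau> \<tau>n \<tau>n') P) \<and>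
    (\<exists>Q. represents c idx (Q_elt idx c \<tau>0 \<tau>0') Q) \<and>
    (\<forall>P Q. represents c idx (P_elt idx \<tau> \<tau>n \<tau>n') P \<longrightarrow>
       represents c idx (Q_elt idx c \<tau>0 \<tau>0') Q \<longrightarrow>
       (\<forall>i\<in>{1..2 * n}. \<forall>j\<in>{1..2 * n}.
          (int i - int j \<notin> {0, int n, - int n} \<longrightarrow>
             P i j = mul (u_i idx \<tau>n \<tau>n' j * b_ij idx \<tau> i j * ap_ij idx \<tau> i j *
               (\<Prod>l\<in>primed n i j. a_ij idx \<tau> j l))) \<and>
          P i i = mul (u_i idx \<tau>n \<tau>n' i * (\<Prod>l\<in>primed n i i. a_ij idx \<tau> i l)) \<and>
          (int i - int j \<in> {int n, - int n} \<longrightarrow>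
             P i j = mul (mconst (\<tau> ^ (2 * n - 2) * \<tau>n)) - (\<Sum>l\<in>{1..2 * n} - {j}. P i l)) \<and>
          (i = j \<longrightarrow> Q i j = mul (ut_i idx c \<tau>0 \<tau>0' j) \<circ> shift c (eps idx j)) \<and>
          (int i - int j \<in> {int n, - int n} \<longrightarrow> Q i j = mul (vt_i idx c \<tau>0 \<tau>0' i)) \<and>
          (int i - int j \<notin> {0, int n, - int n} \<longrightarrow> Q i j = 0)))"
proof -
  interpret coord_enum idx n
    by unfold_locales (use n idx in simp_all)
  have main: "\<forall>i\<in>I. \<forall>j\<in>I.
      (int i - int j \<notin> {0, int n, - int n} \<longrightarrow>
         P i j = mul (u_i idx \<tau>n \<tau>n' j * b_ij idx \<tau> i j * ap_ij idx \<tau> i j *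
           (\<Prod>l\<in>primed n i j. a_ij idx \<tau> j l))) \<and>
      P i i = mul (u_i idx \<tau>n \<tau>n' i * (\<Prod>l\<in>primed n i i. a_ij idx \<tau> i l)) \<and>
      (int i - int j \<in> {int n, - int n} \<longrightarrow>
         P i j = mul (mconst (\<tau> ^ (2 * n - 2) * \<tau>n)) - (\<Sum>l\<in>I - {j}. P i l)) \<and>
      (i = j \<longrightarrow> Q i j = mul (ut_i idx c \<tau>0 \<tau>0' j) \<circ> shift c (eps idx j)) \<and>
      (int i - int j \<in> {int n, - int n} \<longrightarrow> Q i j = mul (vt_i idx c \<tau>0 \<tau>0' i)) \<and>
      (int i - int j \<notin> {0, int n, - int n} \<longrightarrow> Q i j = 0)" (is "\<forall>i\<in>I. \<forall>j\<in>I. ?claim i j")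
    if P: "represents c idx (P_elt idx \<tau> \<tau>n \<tau>n') P" and Q: "represents c idx (Q_elt idx c \<tau>0 \<tau>0') Q"
    for P Q
  proof (intro ballI)
    fix i j assume ij: "i \<in> I" "j \<in> I"
    \<comment> \<open>The whole matrix is identified, not just the entry at \<open>i\<close>,
      \<open>j\<close>, because the row sum formula involves all other entries of the row.\<close>
    have Pm: "P k l = mul (P_coeff \<tau> \<tau>n \<tau>n' k l)" if "k \<in> I" "l \<in> I" for k l
      by (rule represents_unique[OF P represents_P that])
    have Qm: "Q i j = Q_mat c \<tau>0 \<tau>0' i j"
      by (rule represents_unique[OF Q represents_Q ij])
    have "(\<Sum>l\<in>I - {opp i}. P i l) = (\<Sum>l\<in>I - {opp i}. mul (P_coeff \<tau> \<tau>n \<tau>n' i l))"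
      using ij by (intro sum.cong) (auto simp: Pm)
    with mul_P_coeff_opp[OF ij(1), of \<tau> \<tau>n \<tau>n']
    have "P i (opp i) = mul (mconst (\<tau> ^ (2 * n - 2) * \<tau>n)) - (\<Sum>l\<in>I - {opp i}. P i l)"
      by (simp only: Pm[OF ij(1) opp_in[OF ij(1)]])
    moreover have "P i j = mul (u_i idx \<tau>n \<tau>n' j * b_ij idx \<tau> i j * ap_ij idx \<tau> i j *
        (\<Prod>l\<in>primed n i j. a_ij idx \<tau> j l))" if "j \<noteq> i" "j \<noteq> opp i"
      using that by (simp add: Pm[OF ij] P_coeff_def P_off_def)
    moreover have "P i i = mul (u_i idx \<tau>n \<tau>n' i * (\<Prod>l\<in>primed n i i. a_ij idx \<tau> i l))"
      using opp_neq[OF ij(1)] by (simp add: Pm[OF ij(1) ij(1)] P_coeff_def P_off_def)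
    \<comment> \<open>The diagonal and opposite positions are disjoint, so the case order in
      \<open>Q_mat\<close> agrees with the claimed cases.\<close>
    moreover have "j = opp i \<longrightarrow> j \<noteq> i" using opp_neq[OF ij(1)] by simp
    ultimately show "?claim i j"
      unfolding diff_pm_iff[OF ij] diff_iff[OF ij] Qm Q_mat_def by auto
  qed
  show ?thesis
    unfolding I_def[symmetric]
    by (intro conjI exI allI impI) (rule represents_P represents_Q main | assumption)+
qed

end
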